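(* The Temperley-Lieb algebra $TL_n$ has a presentation with invertible generators $g_{ji}$ $(1\le i<j\le n)$ satisfying the relations $$ \begin{array}{l} g_{lk}g_{ji}=g_{ji}g_{lk} \quad\mbox{for } 1\le k<l\le n,\ 1\le i<j\le n \mbox{ with } (l-j)(l-i)(k-j)(k-i)>0;\\ g_{kj}g_{ji}=g_{ji}g_{ki}=g_{ki}g_{kj} \quad\mbox{for } 1\le i<j<k\le n;\\ g_{ji}^2=(t-1)g_{ji}+t \quad\mbox{for } 1\le i<j\le n;\\ g_{ji}g_{kj}+t\,g_{kj}g_{ji}+g_{kj}+g_{ji}+t\,g_{ki}+1=0 \quad\mbox{for } 1\le i<j<k\le n. \end{array} $$ The generators $g_{ji}$ are related to the generators $h_1,\ldots,h_{n-1}$ of $TL_n$ by $$g_{ji}=h_{j-1}h_{j-2}\cdots h_{i+1}\,h_i\,h_{i+1}^{-1}\cdots h_{j-2}^{-1}h_{j-1}^{-1}.$$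
   Context: Let $\tau$ be a nonzero complex number. The Temperley-Lieb algebra $TL_n$ is the unital associative $\mathbb{C}$-algebra defined by (non-invertible) generators $e_1,\ldots,e_{n-1}$ and relations $e_ie_j=e_je_i$ for $|i-j|\ge 2$; $e_i^2=e_i$; $e_ie_{i\pm1}e_i=\tau e_i$. Choose $t\in\mathbb{C}$ such that $\tau^{-1}=2+t+t^{-1}$ (so $t\neq 0$ and $t\neq -1$), and set $h_i=(t+1)e_i-1$. Then $TL_n$ is equivalently presented by invertible generators $h_1,\ldots,h_{n-1}$ with the relations (1) $h_ih_j=h_jh_i$ if $|i-j|\ge 2$; (2) $h_ih_{i+1}h_i=h_{i+1}h_ih_{i+1}$ for $1\le i\le n-2$; (3) $h_i^2=(t-1)h_i+t$ for $1\le i\le n-1$; (4) $h_ih_{i+1}h_i+h_ih_{i+1}+h_{i+1}h_i+h_i+h_{i+1}+1=0$ for $1\le i\le n-2$. A presentation with invertible generators means a presentation as a unital associative $\mathbb{C}$-algebra in which formal two-sided inverses of the generators are adjoined. *)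

theory Defs
  imports
    Complex_Main
    "HOL-Library.Poly_Mapping"
    "HOL-Algebra.QuotRing"
    "HOL-Algebra.Module"
begin

text \<open>
  The free monoid is a separate type, written additively, because
  \<^theory>\<open>HOL-Library.Poly_Mapping\<close> defines the convolution product of finitely supported
  functions over an additively written (not necessarily commutative) monoid. Hence
  \<open>'x free_monoid \<Rightarrow>\<^sub>0 complex\<close> is the algebra of noncommutative polynomials with
  complex coefficients in variables from \<open>'x\<close>.
\<close>

datatype 'x free_monoid = Word (letters: "'x list")

instantiation free_monoid :: (type) monoid_add
begin

definition zero_free_monoid :: "'x free_monoid"
  where "zero_free_monoid = Word []"

definition plus_free_monoid :: "'x free_monoid \<Rightarrow> 'x free_monoid \<Rightarrow> 'x free_monoid"
  where "plus_free_monoid u v = Word (letters u @ letters v)"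

instance
  by standard (simp_all add: zero_free_monoid_def plus_free_monoid_def)

end

type_synonym 'x nc_poly = "'x free_monoid \<Rightarrow>\<^sub>0 complex"

definition gen :: "'x \<Rightarrow> 'x nc_poly"
  where "gen x = Poly_Mapping.single (Word [x]) 1"

definition scale :: "complex \<Rightarrow> 'x nc_poly \<Rightarrow> 'x nc_poly"
  where "scale c p = Poly_Mapping.map ((*) c) p"

definition free_algebra :: "'x set \<Rightarrow> (complex, 'x nc_poly) module"
  where "free_algebra X =
    \<lparr>carrier = {p. \<forall>w\<in>Poly_Mapping.keys p. set (letters w) \<subseteq> X},
     mult = (*), one = 1, zero = 0, add = (+), smult = scale\<rparr>"

text \<open>
  Complex algebras are records of type \<^typ>\<open>(complex, 'a) module\<close>, used here only for their
  ring operations and scalar multiplication (the multiplication need not be commutative).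
  The constant \<^const>\<open>FactRing\<close> forgets the scalar multiplication, which is restored below on
  cosets in the same way as \<^const>\<open>rcoset_mult\<close> does for the product.
  Ideals, and the generated ideal \<open>Idl\<close>, are two-sided in HOL-Algebra.
\<close>

definition quotient_algebra :: "(complex, 'a) module \<Rightarrow> 'a set \<Rightarrow> (complex, 'a set) module"
  where "quotient_algebra A I =
    \<lparr>carrier = carrier (A Quot I), mult = mult (A Quot I), one = one (A Quot I),
     zero = zero (A Quot I), add = add (A Quot I),
     smult = (\<lambda>c B. \<Union>b\<in>B. I +>\<^bsub>A\<^esub> (c \<odot>\<^bsub>A\<^esub> b))\<rparr>"

definition algebra_iso ::
    "(complex, 'a) module \<Rightarrow> (complex, 'b) module \<Rightarrow> ('a \<Rightarrow> 'b) set"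
  where "algebra_iso A B =
    {f \<in> ring_iso A B. \<forall>c. \<forall>x\<in>carrier A. f (c \<odot>\<^bsub>A\<^esub> x) = c \<odot>\<^bsub>B\<^esub> f x}"

text \<open>
  A relation \<open>u = v\<close> is represented by the element \<open>u - v\<close> of the free algebra.
\<close>

definition relation_ideal :: "'x set \<Rightarrow> 'x nc_poly set \<Rightarrow> 'x nc_poly set"
  where "relation_ideal X R = Idl\<^bsub>free_algebra X\<^esub> R"

definition presented_algebra ::
    "'x set \<Rightarrow> 'x nc_poly set \<Rightarrow> (complex, 'x nc_poly set) module"
  where "presented_algebra X R = quotient_algebra (free_algebra X) (relation_ideal X R)"

definition presented_gen :: "'x set \<Rightarrow> 'x nc_poly set \<Rightarrow> 'x \<Rightarrow> 'x nc_poly set"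
  where "presented_gen X R x = relation_ideal X R +>\<^bsub>free_algebra X\<^esub> gen x"

datatype 'x with_inverse = Gen 'x | Gen_inv 'x

definition inverse_gens :: "'x set \<Rightarrow> 'x with_inverse set"
  where "inverse_gens X = Gen ` X \<union> Gen_inv ` X"

definition inverse_relations :: "'x set \<Rightarrow> 'x with_inverse nc_poly set"
  where "inverse_relations X =
    {gen (Gen x) * gen (Gen_inv x) - 1 | x. x \<in> X} \<union>
    {gen (Gen_inv x) * gen (Gen x) - 1 | x. x \<in> X}"

definition inv_presented_algebra ::
    "'x set \<Rightarrow> 'x with_inverse nc_poly set \<Rightarrow> (complex, 'x with_inverse nc_poly set) module"
  where "inv_presented_algebra X R =
    presented_algebra (inverse_gens X) (R \<union> inverse_relations X)"

definition inv_presented_gen ::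
    "'x set \<Rightarrow> 'x with_inverse nc_poly set \<Rightarrow> 'x \<Rightarrow> 'x with_inverse nc_poly set"
  where "inv_presented_gen X R x =
    presented_gen (inverse_gens X) (R \<union> inverse_relations X) (Gen x)"

definition TL_relations :: "nat \<Rightarrow> complex \<Rightarrow> nat nc_poly set"
  where "TL_relations n \<tau> =
    {gen i * gen j - gen j * gen i | i j.
       i \<in> {1..<n} \<and> j \<in> {1..<n} \<and> \<bar>int i - int j\<bar> \<ge> 2} \<union>
    {gen i * gen i - gen i | i. i \<in> {1..<n}} \<union>
    {gen i * gen j * gen i - scale \<tau> (gen i) | i j.
       i \<in> {1..<n} \<and> j \<in> {1..<n} \<and> (j = i + 1 \<or> i = j + 1)}"

definition TL :: "nat \<Rightarrow> complex \<Rightarrow> (complex, nat nc_poly set) module"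
  where "TL n \<tau> = presented_algebra {1..<n} (TL_relations n \<tau>)"

definition TL_e :: "nat \<Rightarrow> complex \<Rightarrow> nat \<Rightarrow> nat nc_poly set"
  where "TL_e n \<tau> i = presented_gen {1..<n} (TL_relations n \<tau>) i"

definition TL_h :: "nat \<Rightarrow> complex \<Rightarrow> complex \<Rightarrow> nat \<Rightarrow> nat nc_poly set"
  where "TL_h n \<tau> t i =
    ((t + 1) \<odot>\<^bsub>TL n \<tau>\<^esub> TL_e n \<tau> i) \<ominus>\<^bsub>TL n \<tau>\<^esub> \<one>\<^bsub>TL n \<tau>\<^esub>"

definition list_product :: "('a, 'b) monoid_scheme \<Rightarrow> 'a list \<Rightarrow> 'a"
  where "list_product A xs = foldr (mult A) xs (one A)"

text \<open>
  The element \<open>h\<^bsub>j-1\<^esub> \<dots> h\<^bsub>i+1\<^esub> h\<^bsub>i\<^esub> h\<^bsub>i+1\<^esub>\<^sup>-\<^sup>1 \<dots> h\<^bsub>j-1\<^esub>\<^sup>-\<^sup>1\<close>, for \<open>i < j\<close>.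
\<close>

definition TL_g :: "nat \<Rightarrow> complex \<Rightarrow> complex \<Rightarrow> nat \<Rightarrow> nat \<Rightarrow> nat nc_poly set"
  where "TL_g n \<tau> t j i =
    list_product (TL n \<tau>) (map (TL_h n \<tau> t) (rev [i..<j])) \<otimes>\<^bsub>TL n \<tau>\<^esub>
    list_product (TL n \<tau>) (map (\<lambda>m. inv\<^bsub>TL n \<tau>\<^esub> (TL_h n \<tau> t m)) [i+1..<j])"

text \<open>The pair \<open>(j, i)\<close> is the index of the generator \<open>g\<^bsub>ji\<^esub>\<close>.\<close>

definition g_index :: "nat \<Rightarrow> (nat \<times> nat) set"
  where "g_index n = {(j, i). 1 \<le> i \<and> i < j \<and> j \<le> n}"

abbreviation g_gen :: "nat \<Rightarrow> nat \<Rightarrow> (nat \<times> nat) with_inverse nc_poly"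
  where "g_gen j i \<equiv> gen (Gen (j, i))"

definition g_relations :: "nat \<Rightarrow> complex \<Rightarrow> (nat \<times> nat) with_inverse nc_poly set"
  where "g_relations n t =
    {g_gen l k * g_gen j i - g_gen j i * g_gen l k | i j k l.
       1 \<le> k \<and> k < l \<and> l \<le> n \<and> 1 \<le> i \<and> i < j \<and> j \<le> n \<and>
       (int l - int j) * (int l - int i) * (int k - int j) * (int k - int i) > 0} \<union>
    {g_gen k j * g_gen j i - g_gen j i * g_gen k i | i j k. 1 \<le> i \<and> i < j \<and> j < k \<and> k \<le> n} \<union>
    {g_gen j i * g_gen k i - g_gen k i * g_gen k j | i j k. 1 \<le> i \<and> i < j \<and> j < k \<and> k \<le> n} \<union>
    {g_gen j i * g_gen j i - (scale (t - 1) (g_gen j i) + scale t 1) | i j.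
       1 \<le> i \<and> i < j \<and> j \<le> n} \<union>
    {g_gen j i * g_gen k j + scale t (g_gen k j * g_gen j i) + g_gen k j + g_gen j i +
       scale t (g_gen k i) + 1 | i j k.
       1 \<le> i \<and> i < j \<and> j < k \<and> k \<le> n}"

end

theory Submission
  imports Defs
begin

text \<open>
  The elements \<open>g\<^sub>j\<^sub>i\<close> are the band generators of Birman, Ko and Lee. Conjugation by a suitable unit
  carries any triple \<open>g\<^sub>j\<^sub>i\<close>, \<open>g\<^sub>k\<^sub>j\<close>, \<open>g\<^sub>k\<^sub>i\<close> to the one built from two consecutive \<open>h\<^sub>i\<close>, so the relations
  within a triple need checking only there; the last one then becomes the cubic relation of the
  two \<open>h\<^sub>i\<close>, because \<open>t h\<^sup>-\<^sup>1 = h - (t - 1)\<close>. Commutation holds since \<open>h\<^sub>m\<close> commutes with \<open>g\<^sub>j\<^sub>i\<close>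
  whenever \<open>m\<close> and \<open>m + 1\<close> both lie outside \<open>[i, j]\<close> or both strictly between \<open>i\<close> and \<open>j\<close>.
  Conversely \<open>e\<^sub>i \<mapsto> (g\<^bsub>i+1,i\<^esub> + 1) / (t + 1)\<close> respects the Temperley--Lieb relations, and the two
  homomorphisms are inverse to each other since \<open>g\<^bsub>j+1,j\<^esub> g\<^sub>j\<^sub>i = g\<^bsub>j+1,i\<^esub> g\<^bsub>j+1,j\<^esub>\<close> expresses every
  \<open>g\<^sub>j\<^sub>i\<close> through the \<open>g\<^bsub>i+1,i\<^esub>\<close>.
\<close>

section \<open>Free and presented algebras\<close>

text \<open>No basis or dimension of the algebra enters. A homomorphism out of a presented algebra
  is a choice of values on the letters that satisfies the relations, and these values determine it;
  bijectivity is then a comparison of two composites on generators.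

  The choice of \<open>t\<close> is explained by \<open>x_i = h_i + 1 = (t + 1) e_i\<close>. In
  these terms the quadratic relation is \<open>x_i^2 = (t + 1) x_i\<close> and the cubic one is
  \<open>x_i x_j x_i = t x_i\<close>, while the relation of the idempotents gives the factor
  \<open>\<tau> (t + 1)^2\<close>. The two agree because \<open>2 + t + 1/t = (t + 1)^2 / t\<close>.

  One asymmetry shapes the converse direction. The last band relation yields the cubic relation only
  with the upper of two neighbours as outer factor, whereas \<open>TL\<close> asks for both
  orientations. The missing one needs the braid relation, which is hidden in the three equal
  products.\<close>

locale complex_algebra = ring A for A :: "(complex, 'a) module" (structure) +
  assumes smult_closed [simp, intro]: "x \<in> carrier A \<Longrightarrow> c \<odot> x \<in> carrier A"
    and smult_l_distr: "x \<in> carrier A \<Longrightarrow> (c + d) \<odot> x = c \<odot> x \<oplus> d \<odot> x"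
    and smult_r_distr: "x \<in> carrier A \<Longrightarrow> y \<in> carrier A \<Longrightarrow> c \<odot> (x \<oplus> y) = c \<odot> x \<oplus> c \<odot> y"
    and smult_smult: "x \<in> carrier A \<Longrightarrow> c \<odot> (d \<odot> x) = (c * d) \<odot> x"
    and smult_one [simp]: "x \<in> carrier A \<Longrightarrow> 1 \<odot> x = x"
    and smult_mult_left: "x \<in> carrier A \<Longrightarrow> y \<in> carrier A \<Longrightarrow> (c \<odot> x) \<otimes> y = c \<odot> (x \<otimes> y)"
    and smult_mult_right: "x \<in> carrier A \<Longrightarrow> y \<in> carrier A \<Longrightarrow> x \<otimes> (c \<odot> y) = c \<odot> (x \<otimes> y)"
begin

lemma smult_zero_left [simp]: "x \<in> carrier A \<Longrightarrow> 0 \<odot> x = \<zero>"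
  by (metis add.l_cancel_one' add_0 smult_closed smult_l_distr)

lemma smult_zero_right [simp]: "c \<odot> \<zero> = \<zero>"
  by (metis add.l_cancel_one' l_zero smult_closed smult_r_distr zero_closed)

lemma smult_minus_right: "x \<in> carrier A \<Longrightarrow> c \<odot> (\<ominus> x) = \<ominus> (c \<odot> x)"
  by (metis a_inv_closed add.inv_equality l_neg smult_closed smult_r_distr smult_zero_right)

lemma smult_minus_left: "x \<in> carrier A \<Longrightarrow> (- c) \<odot> x = \<ominus> (c \<odot> x)"
  by (metis add.inv_equality ab_left_minus smult_closed smult_l_distr smult_zero_left)

lemma eq_if_minus_zero: "x \<in> carrier A \<Longrightarrow> y \<in> carrier A \<Longrightarrow> x \<ominus> y = \<zero> \<Longrightarrow> x = y"
  by (metis a_minus_def add.inv_closed add.inv_equality minus_minus)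

lemma list_product_closed [simp]: "set xs \<subseteq> carrier A \<Longrightarrow> list_product A xs \<in> carrier A"
  by (induction xs) (auto simp: list_product_def)

lemma list_product_append:
  "set xs \<subseteq> carrier A \<Longrightarrow> set ys \<subseteq> carrier A \<Longrightarrow>
    list_product A (xs @ ys) = list_product A xs \<otimes> list_product A ys"
proof (induction xs)
  case Nil
  then show ?case using list_product_closed[of ys] by (simp add: list_product_def)
next
  case (Cons x xs)
  then show ?case
    using list_product_closed[of ys] list_product_closed[of xs] 
    by (simp add: list_product_def m_assoc)
qed

end

section \<open>Homomorphisms of complex algebras\<close>

definition algebra_hom ::
    "(complex, 'a) module \<Rightarrow> (complex, 'b) module \<Rightarrow> ('a \<Rightarrow> 'b) set"
  where "algebra_hom A B =
    {f \<in> ring_hom A B. \<forall>c. \<forall>x\<in>carrier A. f (c \<odot>\<^bsub>A\<^esub> x) = c \<odot>\<^bsub>B\<^esub> f x}"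

lemma algebra_homI:
  assumes "\<And>x. x \<in> carrier A \<Longrightarrow> f x \<in> carrier B"
    and "\<And>x y. x \<in> carrier A \<Longrightarrow> y \<in> carrier A \<Longrightarrow> f (x \<otimes>\<^bsub>A\<^esub> y) = f x \<otimes>\<^bsub>B\<^esub> f y"
    and "\<And>x y. x \<in> carrier A \<Longrightarrow> y \<in> carrier A \<Longrightarrow> f (x \<oplus>\<^bsub>A\<^esub> y) = f x \<oplus>\<^bsub>B\<^esub> f y"
    and "f \<one>\<^bsub>A\<^esub> = \<one>\<^bsub>B\<^esub>"
    and "\<And>c x. x \<in> carrier A \<Longrightarrow> f (c \<odot>\<^bsub>A\<^esub> x) = c \<odot>\<^bsub>B\<^esub> f x"
  shows "f \<in> algebra_hom A B"
  using assms by (auto simp: algebra_hom_def ring_hom_def)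

lemma algebra_homD:
  assumes "f \<in> algebra_hom A B"
  shows "x \<in> carrier A \<Longrightarrow> f x \<in> carrier B"
    and "x \<in> carrier A \<Longrightarrow> y \<in> carrier A \<Longrightarrow> f (x \<otimes>\<^bsub>A\<^esub> y) = f x \<otimes>\<^bsub>B\<^esub> f y"
    and "x \<in> carrier A \<Longrightarrow> y \<in> carrier A \<Longrightarrow> f (x \<oplus>\<^bsub>A\<^esub> y) = f x \<oplus>\<^bsub>B\<^esub> f y"
    and "f \<one>\<^bsub>A\<^esub> = \<one>\<^bsub>B\<^esub>"
    and "x \<in> carrier A \<Longrightarrow> f (c \<odot>\<^bsub>A\<^esub> x) = c \<odot>\<^bsub>B\<^esub> f x"
  using assms by (auto simp: algebra_hom_def ring_hom_def)

text \<open>\<open>ring_hom\<close> does not list preservation of zero; here it comes from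
  compatibility with the scalar 0, as negation below comes from the scalar -1.\<close>

lemma algebra_hom_zero:
  assumes "complex_algebra A" "complex_algebra B" "f \<in> algebra_hom A B"
  shows "f \<zero>\<^bsub>A\<^esub> = \<zero>\<^bsub>B\<^esub>"
proof -
  interpret A: complex_algebra A by fact
  interpret B: complex_algebra B by fact
  show ?thesis
    using algebra_homD(5)[OF assms(3), of "\<zero>\<^bsub>A\<^esub>" 0] algebra_homD(1)[OF assms(3), of "\<zero>\<^bsub>A\<^esub>"] by simp
qed

lemma algebra_hom_minus:
  assumes "complex_algebra A" "complex_algebra B" "f \<in> algebra_hom A B"
    and "x \<in> carrier A" "y \<in> carrier A"
  shows "f (x \<ominus>\<^bsub>A\<^esub> y) = f x \<ominus>\<^bsub>B\<^esub> f y"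
proof -
  interpret A: complex_algebra A by fact
  interpret B: complex_algebra B by fact
  have "f (\<ominus>\<^bsub>A\<^esub> y) = \<ominus>\<^bsub>B\<^esub> f y"
    using algebra_homD(5)[OF assms(3), of y "-1"] algebra_homD(1)[OF assms(3), of y] assms
    by (simp add: A.smult_minus_left B.smult_minus_left)
  then show ?thesis
    using assms algebra_homD[OF assms(3)] by (simp add: a_minus_def)
qed

lemma algebra_hom_comp:
  assumes "f \<in> algebra_hom A B" "g \<in> algebra_hom B C"
  shows "g \<circ> f \<in> algebra_hom A C"
  using algebra_homD[OF assms(1)] algebra_homD[OF assms(2)] by (intro algebra_homI) auto

lemma algebra_hom_id: "(\<lambda>x. x) \<in> algebra_hom A A"
  by (intro algebra_homI) auto

lemma algebra_hom_inv:
  assumes "complex_algebra A" "complex_algebra B" "f \<in> algebra_hom A B" "x \<in> Units A"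
  shows "f x \<in> Units B" and "f (inv\<^bsub>A\<^esub> x) = inv\<^bsub>B\<^esub> (f x)"
proof -
  interpret A: complex_algebra A by fact
  interpret B: complex_algebra B by fact
  have *: "f x \<in> carrier B" "f (inv\<^bsub>A\<^esub> x) \<in> carrier B"
    "f x \<otimes>\<^bsub>B\<^esub> f (inv\<^bsub>A\<^esub> x) = \<one>\<^bsub>B\<^esub>" "f (inv\<^bsub>A\<^esub> x) \<otimes>\<^bsub>B\<^esub> f x = \<one>\<^bsub>B\<^esub>"
    using algebra_homD(1,4)[OF assms(3)] algebra_homD(2)[OF assms(3), symmetric] assms(4) 
    by (auto simp: A.Units_closed)
  then show "f x \<in> Units B" by (auto simp: Units_def)
  show "f (inv\<^bsub>A\<^esub> x) = inv\<^bsub>B\<^esub> (f x)"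
    using * B.inv_char by metis
qed

section \<open>The free algebra of noncommutative polynomials\<close>

lemma scale_conv_mult: "scale c p = Poly_Mapping.single 0 c * p"
  by (simp add: scale_def mult_map_scale_conv_mult)

text \<open>Keeping the support inside \<open>S\<close> in every step makes membership in a carrier
  available to the induction: \<open>S\<close> is later the set of words over the alphabet, or
  \<open>UNIV\<close> when no restriction is wanted. Each step adds a monomial, so that additivity
  can be applied.\<close>

lemma poly_mapping_add_single_induct [consumes 1, case_names zero add]:
  assumes "Poly_Mapping.keys p \<subseteq> S"
    and "P 0"
    and "\<And>w c q. w \<in> S \<Longrightarrow> Poly_Mapping.keys q \<subseteq> S \<Longrightarrow> P q \<Longrightarrow> P (Poly_Mapping.single w c + q)"
  shows "P p"
  using assms(1)
proof (induction p rule: update_induct)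
  case const
  then show ?case using assms(2) by simp
next
  case (update f a b)
  have "Poly_Mapping.update a b f = Poly_Mapping.single a b + f"
    using update(1) by (intro poly_mapping_eqI)
      (auto simp: lookup_update lookup_add lookup_single when_def in_keys_iff)
  moreover have "Poly_Mapping.keys (Poly_Mapping.update a b f) = insert a (Poly_Mapping.keys f)"
    using update(1,2) by (auto simp: in_keys_iff lookup_update split: if_splits)
  ultimately show ?case using update assms(3) by auto
qed

text \<open>Scaling is multiplication by a constant polynomial, so the scalar laws become ring laws.
  The only one that is not immediate in a noncommutative ring is that constants are central, which
  is this lemma.\<close>

lemma single_zero_commute:
  fixes p :: "'x nc_poly"
  shows "p * Poly_Mapping.single 0 c = Poly_Mapping.single 0 c * p"
proof -
  have "Poly_Mapping.keys p \<subseteq> UNIV" by simp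
  then show ?thesis
    by (induction p rule: poly_mapping_add_single_induct)
      (simp_all add: distrib_left distrib_right mult_single mult.commute)
qed

lemma mem_carrier_free_algebra:
  "p \<in> carrier (free_algebra X) \<longleftrightarrow> Poly_Mapping.keys p \<subseteq> {w. set (letters w) \<subseteq> X}"
  by (auto simp: free_algebra_def)

lemma carrier_free_algebra_mult:
  assumes "p \<in> carrier (free_algebra X)" "q \<in> carrier (free_algebra X)"
  shows "p * q \<in> carrier (free_algebra X)"
proof -
  have "set (letters w) \<subseteq> X" if w: "w \<in> Poly_Mapping.keys (p * q)" for w
  proof -
    obtain u v where "w = u + v" "u \<in> Poly_Mapping.keys p" "v \<in> Poly_Mapping.keys q"
      using subsetD[OF Poly_Mapping.keys_mult w] by blast
    then show ?thesis
      using assms by (auto simp: free_algebra_def plus_free_monoid_def)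
  qed
  then show ?thesis by (auto simp: free_algebra_def)
qed

lemma carrier_free_algebra_add:
  assumes "p \<in> carrier (free_algebra X)" "q \<in> carrier (free_algebra X)"
  shows "p + q \<in> carrier (free_algebra X)"
  using assms Poly_Mapping.keys_add[of p q] unfolding mem_carrier_free_algebra by blast

lemma carrier_free_algebra_single:
  "set (letters w) \<subseteq> X \<Longrightarrow> Poly_Mapping.single w c \<in> carrier (free_algebra X)"
  by (auto simp: mem_carrier_free_algebra)

lemma carrier_free_algebra_one: "1 \<in> carrier (free_algebra X)"
  using carrier_free_algebra_single[of 0 X 1] by (simp add: zero_free_monoid_def flip: single_one)

lemma carrier_free_algebra_scale:
  assumes "p \<in> carrier (free_algebra X)"
  shows "scale c p \<in> carrier (free_algebra X)"
  unfolding scale_conv_mult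
  using assms by (intro carrier_free_algebra_mult carrier_free_algebra_single)
    (auto simp: zero_free_monoid_def)

lemma carrier_free_algebra_uminus:
  assumes "p \<in> carrier (free_algebra X)"
  shows "- p \<in> carrier (free_algebra X)"
  using assms by (simp add: mem_carrier_free_algebra)

lemma carrier_free_algebra_gen: "x \<in> X \<Longrightarrow> gen x \<in> carrier (free_algebra X)"
  by (simp add: gen_def carrier_free_algebra_single)

lemma free_algebra_simps:
  "mult (free_algebra X) = (*)" "one (free_algebra X) = 1" "zero (free_algebra X) = 0"
  "add (free_algebra X) = (+)" "smult (free_algebra X) = scale"
  by (simp_all add: free_algebra_def)

lemmas carrier_free_algebra_intros =
  carrier_free_algebra_mult carrier_free_algebra_add carrier_free_algebra_one
  carrier_free_algebra_scale carrier_free_algebra_uminus carrier_free_algebra_gen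

lemma free_algebra_complex_algebra: "complex_algebra (free_algebra X)"
proof -
  have "abelian_group (free_algebra X)"
  proof (rule abelian_groupI)
    show "\<exists>y\<in>carrier (free_algebra X). y \<oplus>\<^bsub>free_algebra X\<^esub> x = \<zero>\<^bsub>free_algebra X\<^esub>"
      if "x \<in> carrier (free_algebra X)" for x
      using carrier_free_algebra_uminus[OF that]
      by (intro bexI[of _ "- x"]) (simp_all add: free_algebra_simps)
  qed (auto simp: free_algebra_simps add_ac carrier_free_algebra_add,
       simp add: mem_carrier_free_algebra)
  moreover have "monoid (free_algebra X)"
    by (rule monoidI) (auto simp: free_algebra_simps mult.assoc carrier_free_algebra_intros)
  ultimately have "ring (free_algebra X)"
    by (rule ringI) (auto simp: free_algebra_simps algebra_simps)
  then show ?thesis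
  proof (intro complex_algebra.intro complex_algebra_axioms.intro)
    fix c d and x y :: "'a nc_poly"
    show "(c + d) \<odot>\<^bsub>free_algebra X\<^esub> x =
        c \<odot>\<^bsub>free_algebra X\<^esub> x \<oplus>\<^bsub>free_algebra X\<^esub> d \<odot>\<^bsub>free_algebra X\<^esub> x"
      by (simp add: free_algebra_simps scale_conv_mult distrib_right single_add)
    show "x \<otimes>\<^bsub>free_algebra X\<^esub> (c \<odot>\<^bsub>free_algebra X\<^esub> y) =
        c \<odot>\<^bsub>free_algebra X\<^esub> (x \<otimes>\<^bsub>free_algebra X\<^esub> y)"
      by (simp add: free_algebra_simps scale_conv_mult mult.assoc[symmetric] single_zero_commute)
    show "c \<odot>\<^bsub>free_algebra X\<^esub> (d \<odot>\<^bsub>free_algebra X\<^esub> x) = (c * d) \<odot>\<^bsub>free_algebra X\<^esub> x"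
      by (simp add: free_algebra_simps scale_conv_mult mult.assoc[symmetric] mult_single)
    show "c \<odot>\<^bsub>free_algebra X\<^esub> x \<in> carrier (free_algebra X)" if "x \<in> carrier (free_algebra X)"
      using that by (simp add: free_algebra_simps carrier_free_algebra_scale)
  qed (auto simp: free_algebra_simps scale_conv_mult algebra_simps)
qed

text \<open>Relations are written with the type class subtraction, while ideals and cosets speak of
  the subtraction of the record.\<close>

lemma free_algebra_minus:
  assumes "p \<in> carrier (free_algebra X)" "q \<in> carrier (free_algebra X)"
  shows "p \<ominus>\<^bsub>free_algebra X\<^esub> q = p - q"
proof -
  interpret complex_algebra "free_algebra X" by (rule free_algebra_complex_algebra)
  have "\<ominus>\<^bsub>free_algebra X\<^esub> q = - q"
    using assms by (intro add.inv_equality) (auto simp: free_algebra_simps carrier_free_algebra_uminus)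
  then show ?thesis by (simp add: a_minus_def free_algebra_simps)
qed

lemma free_algebra_induct [consumes 1, case_names zero add]:
  assumes "p \<in> carrier (free_algebra X)"
    and "P 0"
    and "\<And>w c q. set (letters w) \<subseteq> X \<Longrightarrow> q \<in> carrier (free_algebra X) \<Longrightarrow> P q \<Longrightarrow>
      P (Poly_Mapping.single w c + q)"
  shows "P p"
  using assms(1) unfolding mem_carrier_free_algebra
  by (induction p rule: poly_mapping_add_single_induct)
    (use assms(2,3) in \<open>auto simp: mem_carrier_free_algebra\<close>)

section \<open>Evaluation homomorphisms of the free algebra\<close>

definition free_lift :: "(complex, 'a) module \<Rightarrow> ('x \<Rightarrow> 'a) \<Rightarrow> 'x nc_poly \<Rightarrow> 'a"
  where "free_lift A F p =
    (\<Oplus>\<^bsub>A\<^esub>w\<in>Poly_Mapping.keys p. Poly_Mapping.lookup p w \<odot>\<^bsub>A\<^esub> list_product A (map F (letters w)))"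

context complex_algebra
begin

context
  fixes F :: "'x \<Rightarrow> 'a" and X :: "'x set"
  assumes F: "\<And>x. x \<in> X \<Longrightarrow> F x \<in> carrier A"
begin

lemma word_closed:
  "set (letters w) \<subseteq> X \<Longrightarrow> list_product A (map F (letters w)) \<in> carrier A"
  using F by (intro list_product_closed) auto

text \<open>Terms outside the support have coefficient 0. A larger index set is needed for sums,
  since cancellation may make the support of \<open>p + q\<close> smaller than the union of the two
  supports.\<close>

lemma free_lift_superset:
  assumes "finite S" "Poly_Mapping.keys p \<subseteq> S" "S \<subseteq> {w. set (letters w) \<subseteq> X}"
  shows "free_lift A F p =
    (\<Oplus>w\<in>S. Poly_Mapping.lookup p w \<odot> list_product A (map F (letters w)))"
  unfolding free_lift_def
  by (rule add.finprod_mono_neutral_cong_left)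
    (use assms in \<open>auto simp: in_keys_iff word_closed subset_iff\<close>)

lemma free_lift_closed:
  "p \<in> carrier (free_algebra X) \<Longrightarrow> free_lift A F p \<in> carrier A"
  unfolding free_lift_def mem_carrier_free_algebra
  by (intro finsum_closed) (auto intro!: word_closed)

lemma free_lift_add:
  assumes "p \<in> carrier (free_algebra X)" "q \<in> carrier (free_algebra X)"
  shows "free_lift A F (p + q) = free_lift A F p \<oplus> free_lift A F q"
proof -
  let ?S = "Poly_Mapping.keys p \<union> Poly_Mapping.keys q"
  have S: "finite ?S" "?S \<subseteq> {w. set (letters w) \<subseteq> X}"
    using assms by (auto simp: mem_carrier_free_algebra)
  have "free_lift A F (p + q) =
    (\<Oplus>w\<in>?S. Poly_Mapping.lookup (p + q) w \<odot> list_product A (map F (letters w)))"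
    using S Poly_Mapping.keys_add[of p q] by (intro free_lift_superset) auto
  also have "\<dots> = (\<Oplus>w\<in>?S. Poly_Mapping.lookup p w \<odot> list_product A (map F (letters w)) \<oplus>
      Poly_Mapping.lookup q w \<odot> list_product A (map F (letters w)))"
    using S by (intro add.finprod_cong') (auto simp: lookup_add smult_l_distr word_closed subset_iff)
  also have "\<dots> = (\<Oplus>w\<in>?S. Poly_Mapping.lookup p w \<odot> list_product A (map F (letters w))) \<oplus>
      (\<Oplus>w\<in>?S. Poly_Mapping.lookup q w \<odot> list_product A (map F (letters w)))"
    using S by (intro add.finprod_multf) (auto simp: word_closed subset_iff)
  also have "\<dots> = free_lift A F p \<oplus> free_lift A F q"
    using S free_lift_superset[of ?S p] free_lift_superset[of ?S q] by simp
  finally show ?thesis .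
qed

lemma free_lift_single:
  assumes "set (letters w) \<subseteq> X"
  shows "free_lift A F (Poly_Mapping.single w c) = c \<odot> list_product A (map F (letters w))"
proof -
  have "free_lift A F (Poly_Mapping.single w c) = (\<Oplus>v\<in>{w}.
      Poly_Mapping.lookup (Poly_Mapping.single w c) v \<odot> list_product A (map F (letters v)))"
    using assms by (intro free_lift_superset) auto
  also have "\<dots> = c \<odot> list_product A (map F (letters w))"
    using assms word_closed[of w] by simp
  finally show ?thesis .
qed

lemma free_lift_zero: "free_lift A F 0 = \<zero>"
  by (simp add: free_lift_def)

lemma free_lift_mult:
  assumes "p \<in> carrier (free_algebra X)" "q \<in> carrier (free_algebra X)"
  shows "free_lift A F (p * q) = free_lift A F p \<otimes> free_lift A F q"
proof -
  \<comment> \<open>Bilinearity leaves the product of two monomials, where words are concatenated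
    and both coefficients can be pulled out. This first induction has a monomial as left factor; the
    outer one then varies the left factor.\<close>
  have single: "free_lift A F (Poly_Mapping.single v c * q) =
      free_lift A F (Poly_Mapping.single v c) \<otimes> free_lift A F q"
    if v: "set (letters v) \<subseteq> X" and "q \<in> carrier (free_algebra X)" for v c q
    using that(2)
  proof (induction q rule: free_algebra_induct)
    case zero
    then show ?case using v by (simp add: free_lift_zero free_lift_single word_closed)
  next
    case (add w d q)
    have w: "set (letters (v + w)) \<subseteq> X" using v add by (simp add: plus_free_monoid_def)
    have cl: "Poly_Mapping.single v c \<in> carrier (free_algebra X)"
      "Poly_Mapping.single w d \<in> carrier (free_algebra X)"
      using v add by (auto intro: carrier_free_algebra_single)
    have "free_lift A F (Poly_Mapping.single v c * Poly_Mapping.single w d) =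
        free_lift A F (Poly_Mapping.single v c) \<otimes> free_lift A F (Poly_Mapping.single w d)"
    proof -
      have "list_product A (map F (letters (v + w))) =
          list_product A (map F (letters v)) \<otimes> list_product A (map F (letters w))"
        using v add(1) F by (simp add: plus_free_monoid_def, intro list_product_append) auto
      then show ?thesis
        using v w add(1) word_closed[of v] word_closed[of w]
        by (simp add: mult_single free_lift_single smult_mult_left smult_mult_right smult_smult
            mult.commute)
    qed
    then show ?case
      using add cl
      by (simp add: distrib_left free_lift_add carrier_free_algebra_mult free_lift_closed r_distr)
  qed
  show ?thesis
    using assms(1)
  proof (induction p rule: free_algebra_induct)
    case zero
    then show ?case using assms(2) by (simp add: free_lift_zero free_lift_closed)
  next
    case (add w d p)
    have "Poly_Mapping.single w d \<in> carrier (free_algebra X)"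
      using add by (auto intro: carrier_free_algebra_single)
    then show ?case
      using add assms(2) single[of w q d]
      by (simp add: distrib_right free_lift_add carrier_free_algebra_mult free_lift_closed l_distr)
  qed
qed

lemma free_lift_algebra_hom: "free_lift A F \<in> algebra_hom (free_algebra X) A"
proof -
  have const: "free_lift A F (Poly_Mapping.single 0 c) = c \<odot> \<one>" for c
    using free_lift_single[of 0 c] by (simp add: zero_free_monoid_def list_product_def)
  have const_closed: "Poly_Mapping.single 0 c \<in> carrier (free_algebra X)" for c
    by (rule carrier_free_algebra_single) (simp add: zero_free_monoid_def)
  show ?thesis
    using const[of 1]
    by (intro algebra_homI)
      (simp_all add: free_algebra_simps free_lift_closed free_lift_mult free_lift_add
        scale_conv_mult const const_closed smult_mult_left)
qed

lemma free_lift_gen: "x \<in> X \<Longrightarrow> free_lift A F (gen x) = F x"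
  using free_lift_single[of "Word [x]" 1] F[of x] by (simp add: gen_def list_product_def)

end

end

text \<open>A word is a product of letters and a polynomial is a linear combination of words, so
  agreement on letters spreads by one induction on words and one on polynomials.\<close>

lemma free_algebra_hom_eqI:
  assumes "complex_algebra A"
    and f: "f \<in> algebra_hom (free_algebra X) A" and g: "g \<in> algebra_hom (free_algebra X) A"
    and eq: "\<And>x. x \<in> X \<Longrightarrow> f (gen x) = g (gen x)"
    and "p \<in> carrier (free_algebra X)"
  shows "f p = g p"
proof -
  interpret complex_algebra A by fact
  note fD = algebra_homD[OF f, unfolded free_algebra_simps]
    and gD = algebra_homD[OF g, unfolded free_algebra_simps]
  have word: "f (Poly_Mapping.single (Word xs) 1) = g (Poly_Mapping.single (Word xs) 1)"
    if "set xs \<subseteq> X" for xs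
    using that
  proof (induction xs)
    case Nil
    then show ?case using fD(4) gD(4) by (simp add: zero_free_monoid_def flip: single_one)
  next
    case (Cons x xs)
    have "Poly_Mapping.single (Word (x # xs)) (1::complex) = gen x * Poly_Mapping.single (Word xs) 1"
      by (simp add: gen_def mult_single plus_free_monoid_def)
    then show ?case
      using Cons fD(2) gD(2) eq by (simp add: carrier_free_algebra_gen carrier_free_algebra_single)
  qed
  show ?thesis
    using assms(5)
  proof (induction p rule: free_algebra_induct)
    case zero
    then show ?case
      using algebra_hom_zero[OF free_algebra_complex_algebra assms(1)] f g 
      by (metis free_algebra_simps(3))
  next
    case (add w c q)
    have cl: "Poly_Mapping.single w 1 \<in> carrier (free_algebra X)"
      using add by (intro carrier_free_algebra_single) auto
    have "Poly_Mapping.single w c = scale c (Poly_Mapping.single w 1)"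
      by (simp add: scale_conv_mult mult_single)
    moreover have "f (Poly_Mapping.single w 1) = g (Poly_Mapping.single w 1)"
      using word[of "letters w"] add(1) by simp
    ultimately show ?case
      using add fD(3,5) gD(3,5) cl by (simp add: carrier_free_algebra_scale)
  qed
qed

lemma carrier_free_algebra_diff:
  assumes "p \<in> carrier (free_algebra X)" "q \<in> carrier (free_algebra X)"
  shows "p - q \<in> carrier (free_algebra X)"
  using carrier_free_algebra_add[OF assms(1) carrier_free_algebra_uminus[OF assms(2)]] by simp

text \<open>These rules evaluate a homomorphism on relations in the notation in which the relation
  sets are given.\<close>

lemma free_algebra_hom_simps:
  assumes "complex_algebra B" "f \<in> algebra_hom (free_algebra X) B"
  shows "p \<in> carrier (free_algebra X) \<Longrightarrow> q \<in> carrier (free_algebra X) \<Longrightarrow>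
      f (p * q) = f p \<otimes>\<^bsub>B\<^esub> f q"
    and "p \<in> carrier (free_algebra X) \<Longrightarrow> q \<in> carrier (free_algebra X) \<Longrightarrow>
      f (p + q) = f p \<oplus>\<^bsub>B\<^esub> f q"
    and "p \<in> carrier (free_algebra X) \<Longrightarrow> q \<in> carrier (free_algebra X) \<Longrightarrow>
      f (p - q) = f p \<ominus>\<^bsub>B\<^esub> f q"
    and "f 1 = \<one>\<^bsub>B\<^esub>"
    and "p \<in> carrier (free_algebra X) \<Longrightarrow> f (scale c p) = c \<odot>\<^bsub>B\<^esub> f p"
  using algebra_homD[OF assms(2)] algebra_hom_minus[OF free_algebra_complex_algebra assms, of p q]
  by (simp_all add: free_algebra_simps free_algebra_minus)

section \<open>Quotient algebras\<close>

lemma quotient_algebra_simps: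
  "carrier (quotient_algebra A I) = carrier (A Quot I)" "mult (quotient_algebra A I) = mult (A Quot I)"
  "one (quotient_algebra A I) = one (A Quot I)" "zero (quotient_algebra A I) = zero (A Quot I)"
  "add (quotient_algebra A I) = add (A Quot I)"
  by (simp_all add: quotient_algebra_def)

context complex_algebra
begin

context
  fixes I
  assumes I: "ideal I A"
begin

text \<open>Since \<open>c x = (c 1) x\<close>, a two-sided ring ideal is automatically a subspace.
  This is why ring ideals suffice for quotients of algebras.\<close>

lemma smult_ideal: "x \<in> I \<Longrightarrow> c \<odot> x \<in> I"
  using ideal.I_l_closed[OF I, of x "c \<odot> \<one>"] ideal.Icarr[OF I, of x]
  by (simp add: smult_mult_left)

lemma quotient_coset_eq_iff:
  "x \<in> carrier A \<Longrightarrow> y \<in> carrier A \<Longrightarrow> I +> x = I +> y \<longleftrightarrow> x \<ominus> y \<in> I"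
  using quotient_eq_iff_same_a_r_cos[OF I] by auto

lemma quotient_carrier: "carrier (quotient_algebra A I) = (\<lambda>x. I +> x) ` carrier A"
  by (auto simp: quotient_algebra_simps FactRing_simps)

text \<open>The union in \<open>quotient_algebra\<close> ranges over all representatives, but each
  of them contributes the same coset because the ideal is closed under scalars.\<close>

lemma quotient_smult:
  assumes x: "x \<in> carrier A"
  shows "c \<odot>\<^bsub>quotient_algebra A I\<^esub> (I +> x) = I +> (c \<odot> x)"
proof -
  interpret ideal I A by (rule I)
  have "I +> (c \<odot> y) = I +> (c \<odot> x)" if "y \<in> I +> x" for y
  proof -
    have y: "y \<in> carrier A" using that x a_elemrcos_carrier by blast
    then have "y \<ominus> x \<in> I" using that x a_rcos_module_minus[OF ring_axioms, of x y] by simp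
    then have "c \<odot> (y \<ominus> x) \<in> I" by (rule smult_ideal)
    then have "c \<odot> y \<ominus> c \<odot> x \<in> I"
      using x y by (simp add: a_minus_def smult_r_distr smult_minus_right)
    then show ?thesis using x y by (simp add: quotient_coset_eq_iff)
  qed
  then have "(\<Union>y\<in>I +> x. I +> (c \<odot> y)) = (\<Union>y\<in>I +> x. I +> (c \<odot> x))"
    by (rule SUP_cong[OF refl])
  also have "\<dots> = I +> (c \<odot> x)"
    using a_rcos_self[OF x] by blast
  finally show ?thesis by (simp add: quotient_algebra_def)
qed

lemma quotient_complex_algebra: "complex_algebra (quotient_algebra A I)"
proof -
  interpret ideal I A by (rule I)
  interpret Q: ring "A Quot I" by (rule quotient_is_ring)
  \<comment> \<open>The two records share their carrier and ring operations, so the identity carries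
    the ring axioms to the one with scalars.\<close>
  have "id \<in> ring_iso (A Quot I) (quotient_algebra A I)"
    by (rule ring_iso_memI) (auto simp: quotient_algebra_simps)
  from Q.ring_iso_imp_img_ring[OF this] have "ring (quotient_algebra A I)"
    by (simp add: quotient_algebra_def)
  moreover have
    "(I +> x) \<oplus>\<^bsub>quotient_algebra A I\<^esub> (I +> y) = I +> (x \<oplus> y)"
    "(I +> x) \<otimes>\<^bsub>quotient_algebra A I\<^esub> (I +> y) = I +> (x \<otimes> y)"
    if "x \<in> carrier A" "y \<in> carrier A" for x y
    using ring_hom_memE(2,3)[OF rcos_ring_hom that] by (simp_all add: quotient_algebra_simps)
  ultimately show ?thesis
    by (intro complex_algebra.intro complex_algebra_axioms.intro)
      (auto simp: quotient_carrier quotient_smult smult_l_distr smult_r_distr smult_smult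
        smult_mult_left smult_mult_right)
qed

lemma coset_algebra_hom: "(\<lambda>x. I +> x) \<in> algebra_hom A (quotient_algebra A I)"
proof -
  interpret ideal I A by (rule I)
  show ?thesis
    using ring_hom_memE[OF rcos_ring_hom] quotient_smult
    by (intro algebra_homI) (simp_all add: quotient_algebra_simps)
qed

lemma quotient_lift:
  assumes "complex_algebra B" and f: "f \<in> algebra_hom A B"
    and "\<And>x. x \<in> I \<Longrightarrow> f x = \<zero>\<^bsub>B\<^esub>"
  shows "\<exists>\<phi>\<in>algebra_hom (quotient_algebra A I) B. \<forall>x\<in>carrier A. \<phi> (I +> x) = f x"
proof -
  interpret ideal I A by (rule I)
  interpret B: complex_algebra B by fact
  note fD = algebra_homD[OF f] and qD = algebra_homD[OF coset_algebra_hom]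
  \<comment> \<open>A coset is evaluated at a chosen representative. The choice is harmless: two
    representatives differ by an element of \<open>I\<close>, which \<open>f\<close> kills.\<close>
  define \<phi> where "\<phi> C = f (SOME x. x \<in> carrier A \<and> C = I +> x)" for C
  have \<phi>: "\<phi> (I +> x) = f x" if x: "x \<in> carrier A" for x
  proof -
    define y where "y = (SOME y. y \<in> carrier A \<and> I +> x = I +> y)"
    have y: "y \<in> carrier A" "I +> x = I +> y"
      using someI[of "\<lambda>y. y \<in> carrier A \<and> I +> x = I +> y" x] x by (auto simp: y_def)
    then have "y \<ominus> x \<in> I" using x quotient_coset_eq_iff[of y x] by simp
    then have "f y \<ominus>\<^bsub>B\<^esub> f x = \<zero>\<^bsub>B\<^esub>"
      using assms(3) algebra_hom_minus[OF complex_algebra_axioms assms(1) f] x y by metis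
    then have "f y = f x" using x y fD(1) B.eq_if_minus_zero by simp
    then show ?thesis by (simp add: \<phi>_def y_def)
  qed
  have "\<phi> \<in> algebra_hom (quotient_algebra A I) B"
  proof (rule algebra_homI)
    show "\<phi> \<one>\<^bsub>quotient_algebra A I\<^esub> = \<one>\<^bsub>B\<^esub>"
      using qD(4) \<phi>[OF one_closed] fD(4) by simp
  qed (use qD(2,3,5)[symmetric] \<phi> fD in \<open>auto simp: quotient_carrier\<close>)
  then show ?thesis by (rule bexI[rotated]) (simp add: \<phi>)
qed

end

end

section \<open>Presented algebras and their universal property\<close>

locale presentation =
  fixes X :: "'x set" and R :: "'x nc_poly set"
  assumes relations: "R \<subseteq> carrier (free_algebra X)"
begin

text \<open>This is where relations must lie in the carrier: otherwise no ideal contains them and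
  \<open>Idl\<close> would be an intersection over an empty family.\<close>

lemma relation_ideal: "ideal (relation_ideal X R) (free_algebra X)"
proof -
  interpret complex_algebra "free_algebra X" by (rule free_algebra_complex_algebra)
  show ?thesis unfolding relation_ideal_def using relations by (rule genideal_ideal)
qed

sublocale complex_algebra "presented_algebra X R"
  unfolding presented_algebra_def
  by (rule complex_algebra.quotient_complex_algebra[OF free_algebra_complex_algebra relation_ideal])

definition cls :: "'x nc_poly \<Rightarrow> 'x nc_poly set"
  where "cls p = relation_ideal X R +>\<^bsub>free_algebra X\<^esub> p"

lemma cls_algebra_hom: "cls \<in> algebra_hom (free_algebra X) (presented_algebra X R)"
  using complex_algebra.coset_algebra_hom[OF free_algebra_complex_algebra relation_ideal]
  by (simp add: cls_def[abs_def] presented_algebra_def)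

lemma cls_gen: "cls (gen x) = presented_gen X R x"
  by (simp add: cls_def presented_gen_def)

lemma gen_closed: "x \<in> X \<Longrightarrow> presented_gen X R x \<in> carrier (presented_algebra X R)"
  using algebra_homD(1)[OF cls_algebra_hom] carrier_free_algebra_gen cls_gen by metis

lemma cls_simps:
  "p \<in> carrier (free_algebra X) \<Longrightarrow> q \<in> carrier (free_algebra X) \<Longrightarrow>
    cls (p * q) = cls p \<otimes>\<^bsub>presented_algebra X R\<^esub> cls q"
  "p \<in> carrier (free_algebra X) \<Longrightarrow> q \<in> carrier (free_algebra X) \<Longrightarrow>
    cls (p + q) = cls p \<oplus>\<^bsub>presented_algebra X R\<^esub> cls q"
  "cls 1 = \<one>\<^bsub>presented_algebra X R\<^esub>"
  "p \<in> carrier (free_algebra X) \<Longrightarrow> cls (scale c p) = c \<odot>\<^bsub>presented_algebra X R\<^esub> cls p"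
  using algebra_homD[OF cls_algebra_hom] by (simp_all add: free_algebra_simps)

lemma cls_relation:
  assumes "r \<in> R" shows "cls r = \<zero>\<^bsub>presented_algebra X R\<^esub>"
proof -
  interpret F: complex_algebra "free_algebra X" by (rule free_algebra_complex_algebra)
  interpret ideal "relation_ideal X R" "free_algebra X" by (rule relation_ideal)
  have "r \<in> relation_ideal X R"
    using F.genideal_self[OF relations] assms by (auto simp: relation_ideal_def)
  then have "cls r = relation_ideal X R" by (simp add: cls_def a_rcos_const)
  then show ?thesis by (simp add: presented_algebra_def quotient_algebra_simps FactRing_def)
qed

lemma cls_relation_eq:
  assumes "p - q \<in> R" "p \<in> carrier (free_algebra X)" "q \<in> carrier (free_algebra X)"
  shows "cls p = cls q"
proof -
  interpret F: complex_algebra "free_algebra X" by (rule free_algebra_complex_algebra)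
  have "cls p \<ominus>\<^bsub>presented_algebra X R\<^esub> cls q = \<zero>\<^bsub>presented_algebra X R\<^esub>"
    using cls_relation[OF assms(1)] assms(2,3)
      algebra_hom_minus[OF F.complex_algebra_axioms complex_algebra_axioms cls_algebra_hom]
    by (simp add: free_algebra_minus)
  then show ?thesis
    using assms algebra_homD(1)[OF cls_algebra_hom] eq_if_minus_zero by simp
qed

text \<open>The relations are to be checked for any homomorphism \<open>f\<close> with the
  prescribed values, so that applications compute with homomorphism laws and never unfold
  \<open>free_lift\<close>. The kernel of the evaluation is a two-sided ideal; once it contains the
  relations, it contains the ideal they generate.\<close>

lemma universal_property:
  assumes "complex_algebra B" and F: "\<And>x. x \<in> X \<Longrightarrow> F x \<in> carrier B"
    and rel: "\<And>f r. f \<in> algebra_hom (free_algebra X) B \<Longrightarrow> (\<And>x. x \<in> X \<Longrightarrow> f (gen x) = F x) \<Longrightarrow>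
      r \<in> R \<Longrightarrow> f r = \<zero>\<^bsub>B\<^esub>"
  shows "\<exists>\<phi>\<in>algebra_hom (presented_algebra X R) B. \<forall>x\<in>X. \<phi> (presented_gen X R x) = F x"
proof -
  interpret FX: complex_algebra "free_algebra X" by (rule free_algebra_complex_algebra)
  interpret B: complex_algebra B by fact
  let ?f = "free_lift B F"
  have f: "?f \<in> algebra_hom (free_algebra X) B" by (rule B.free_lift_algebra_hom) (rule F)
  have gen: "?f (gen x) = F x" if "x \<in> X" for x by (rule B.free_lift_gen[OF F that])
  interpret h: ring_hom_ring "free_algebra X" B ?f
    by (rule ring_hom_ringI2[OF FX.ring_axioms B.ring_axioms])
      (use f in \<open>simp add: algebra_hom_def\<close>)
  have "R \<subseteq> a_kernel (free_algebra X) B ?f"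
  proof
    fix r assume "r \<in> R"
    moreover from this have "?f r = \<zero>\<^bsub>B\<^esub>" using rel f gen by blast
    ultimately show "r \<in> a_kernel (free_algebra X) B ?f"
      unfolding a_kernel_def' using relations by blast
  qed
  from FX.genideal_minimal[OF h.kernel_is_ideal this]
  have "?f p = \<zero>\<^bsub>B\<^esub>" if "p \<in> relation_ideal X R" for p
    using that unfolding relation_ideal_def a_kernel_def' by blast
  from FX.quotient_lift[OF relation_ideal assms(1) f this]
  obtain \<phi> where "\<phi> \<in> algebra_hom (presented_algebra X R) B"
    and "\<And>p. p \<in> carrier (free_algebra X) \<Longrightarrow> \<phi> (cls p) = ?f p"
    unfolding presented_algebra_def cls_def by blast
  then show ?thesis
    by (intro bexI[of _ \<phi>] ballI) (simp_all add: gen carrier_free_algebra_gen flip: cls_gen)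
qed

lemma hom_eqI:
  assumes "complex_algebra B"
    and "f \<in> algebra_hom (presented_algebra X R) B" "g \<in> algebra_hom (presented_algebra X R) B"
    and "\<And>x. x \<in> X \<Longrightarrow> f (presented_gen X R x) = g (presented_gen X R x)"
    and "a \<in> carrier (presented_algebra X R)"
  shows "f a = g a"
proof -
  obtain p where p: "p \<in> carrier (free_algebra X)" "a = cls p"
    using assms(5) complex_algebra.quotient_carrier[OF free_algebra_complex_algebra relation_ideal]
    by (auto simp: cls_def presented_algebra_def)
  have "(f \<circ> cls) p = (g \<circ> cls) p"
    by (rule free_algebra_hom_eqI[OF assms(1) algebra_hom_comp[OF cls_algebra_hom assms(2)]
      algebra_hom_comp[OF cls_algebra_hom assms(3)] _ p(1)])
      (simp add: cls_gen assms(4))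
  then show ?thesis using p by simp
qed

end

lemma algebra_isoI:
  assumes f: "f \<in> algebra_hom A B" and g: "g \<in> algebra_hom B A"
    and "\<And>x. x \<in> carrier A \<Longrightarrow> g (f x) = x" and "\<And>y. y \<in> carrier B \<Longrightarrow> f (g y) = y"
  shows "f \<in> algebra_iso A B"
proof -
  have "bij_betw f (carrier A) (carrier B)"
    using assms algebra_homD(1)[OF f] algebra_homD(1)[OF g]
    by (intro bij_betw_byWitness[where f' = g]) auto
  then show ?thesis using f by (auto simp: algebra_iso_def algebra_hom_def ring_iso_def)
qed

section \<open>Hecke and Temperley--Lieb relations\<close>

context complex_algebra
begin

lemma smult_diff_one: "x \<in> carrier A \<Longrightarrow> (c - 1) \<odot> x = c \<odot> x \<ominus> x"
  using smult_l_distr[of x c "- 1"] smult_minus_left[of x 1] by (simp add: a_minus_def)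

lemmas ring_normalize = a_minus_def l_distr r_distr l_minus r_minus minus_add a_ac m_assoc
  r_neg r_neg1 r_neg2

text \<open>The relation on \<open>h\<close> reads \<open>(h + 1)(h - t) = 0\<close>; in terms of
  \<open>x = h + 1\<close> it is \<open>x (x - (t + 1)) = 0\<close>. One direction serves the
  \<open>h_i\<close> in \<open>TL\<close>, the other the idempotents built in the band
  algebra.\<close>

lemma quadratic_relation_shift_iff:
  assumes "h \<in> carrier A" "x \<in> carrier A" "h = x \<ominus> \<one>"
  shows "h \<otimes> h = (t - 1) \<odot> h \<oplus> t \<odot> \<one> \<longleftrightarrow> x \<otimes> x = (t + 1) \<odot> x"
proof -
  have t: "t \<odot> h = t \<odot> x \<ominus> t \<odot> \<one>"
    using assms by (simp add: a_minus_def smult_r_distr smult_minus_right)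
  have "h \<otimes> h = x \<otimes> x \<ominus> x \<ominus> x \<oplus> \<one>"
    unfolding assms(3) using assms(2) by (simp add: ring_normalize)
  moreover have "(t - 1) \<odot> h \<oplus> t \<odot> \<one> = t \<odot> x \<ominus> x \<oplus> \<one>"
    unfolding smult_diff_one[OF assms(1)] t unfolding assms(3)
    using smult_closed[OF assms(2), of t] smult_closed[OF one_closed, of t] assms(2) by algebra
  moreover have "x \<otimes> x \<ominus> x \<ominus> x \<oplus> \<one> = t \<odot> x \<ominus> x \<oplus> \<one> \<longleftrightarrow> x \<otimes> x = t \<odot> x \<oplus> x"
  proof
    assume eq: "x \<otimes> x \<ominus> x \<ominus> x \<oplus> \<one> = t \<odot> x \<ominus> x \<oplus> \<one>"
    have "x \<otimes> x = (x \<otimes> x \<ominus> x \<ominus> x \<oplus> \<one>) \<oplus> x \<oplus> x \<ominus> \<one>"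
      using assms(2) by algebra
    also have "\<dots> = t \<odot> x \<oplus> x"
      unfolding eq using assms(2) smult_closed[OF assms(2), of t] by algebra
    finally show "x \<otimes> x = t \<odot> x \<oplus> x" .
  next
    assume eq: "x \<otimes> x = t \<odot> x \<oplus> x"
    show "x \<otimes> x \<ominus> x \<ominus> x \<oplus> \<one> = t \<odot> x \<ominus> x \<oplus> \<one>"
      unfolding eq using assms(2) smult_closed[OF assms(2), of t] by algebra
  qed
  ultimately show ?thesis using assms(2) by (simp add: smult_l_distr)
qed

text \<open>The left side is \<open>(a + 1) b (a + 1) + (a + 1) = x (y - 1) x + x = x y x - (x x -
  x)\<close>, and the quadratic relation turns \<open>x x - x\<close> into
  \<open>t x\<close>.\<close>

lemma cubic_relation_shift_iff:
  assumes "a \<in> carrier A" "b \<in> carrier A" "x \<in> carrier A" "y \<in> carrier A"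
    and a: "a = x \<ominus> \<one>" and b: "b = y \<ominus> \<one>" and x: "x \<otimes> x = (t + 1) \<odot> x"
  shows "a \<otimes> b \<otimes> a \<oplus> a \<otimes> b \<oplus> b \<otimes> a \<oplus> a \<oplus> b \<oplus> \<one> = \<zero> \<longleftrightarrow> x \<otimes> y \<otimes> x = t \<odot> x"
proof -
  have "a \<otimes> b \<otimes> a \<oplus> a \<otimes> b \<oplus> b \<otimes> a \<oplus> a \<oplus> b \<oplus> \<one> = x \<otimes> y \<otimes> x \<ominus> (x \<otimes> x \<ominus> x)"
    unfolding a b using assms(3,4) by (simp add: ring_normalize) algebra
  also have "x \<otimes> x \<ominus> x = t \<odot> x"
    unfolding x smult_l_distr[OF assms(3)] smult_one[OF assms(3)]
    using assms(3) smult_closed[OF assms(3), of t] by algebra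
  finally show ?thesis
    using assms(3,4) eq_if_minus_zero[of "x \<otimes> y \<otimes> x" "t \<odot> x"] by (auto simp: a_minus_def r_neg)
qed

lemma quadratic_relation_Units:
  assumes "t \<noteq> 0" "h \<in> carrier A" "h \<otimes> h = (t - 1) \<odot> h \<oplus> t \<odot> \<one>"
  shows "h \<in> Units A"
proof -
  \<comment> \<open>Solving the quadratic relation for the inverse:
    \<open>h (h - (t - 1)) = t\<close>.\<close>
  define k where "k = inverse t \<odot> (h \<ominus> (t - 1) \<odot> \<one>)"
  have k: "k \<in> carrier A" using assms(2) by (simp add: k_def)
  have "h \<otimes> (h \<ominus> (t - 1) \<odot> \<one>) = t \<odot> \<one>" "(h \<ominus> (t - 1) \<odot> \<one>) \<otimes> h = t \<odot> \<one>"
  proof -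
    have "h \<otimes> (h \<ominus> (t - 1) \<odot> \<one>) = h \<otimes> h \<ominus> (t - 1) \<odot> h"
      using assms(2) by (simp add: a_minus_def r_distr r_minus smult_mult_right)
    moreover have "(h \<ominus> (t - 1) \<odot> \<one>) \<otimes> h = h \<otimes> h \<ominus> (t - 1) \<odot> h"
      using assms(2) by (simp add: a_minus_def l_distr l_minus smult_mult_left)
    moreover have "h \<otimes> h \<ominus> (t - 1) \<odot> h = t \<odot> \<one>"
      unfolding assms(3)
      using smult_closed[OF assms(2), of "t - 1"] smult_closed[OF one_closed, of t] by algebra
    ultimately show "h \<otimes> (h \<ominus> (t - 1) \<odot> \<one>) = t \<odot> \<one>" "(h \<ominus> (t - 1) \<odot> \<one>) \<otimes> h = t \<odot> \<one>"
      by simp_all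
  qed
  then have "h \<otimes> k = \<one>" "k \<otimes> h = \<one>"
    using assms(1,2) by (simp_all add: k_def smult_mult_right smult_mult_left smult_smult)
  then show ?thesis using k assms(2) by (auto simp: Units_def)
qed

text \<open>
  As \<open>t\<cdot>a\<^sup>-\<^sup>1 = a - (t - 1)\<close>, multiplication by \<open>t\<close> turns the conjugate \<open>c = a b a\<^sup>-\<^sup>1\<close> into a
  polynomial in \<open>a\<close> and \<open>b\<close>.
\<close>

lemma band_relation_eq_cubic_relation:
  assumes "a \<in> carrier A" "b \<in> carrier A" "c \<in> carrier A"
    and quad: "a \<otimes> a = (t - 1) \<odot> a \<oplus> t \<odot> \<one>" and ca: "c \<otimes> a = a \<otimes> b"
  shows "b \<otimes> a \<oplus> t \<odot> (a \<otimes> b) \<oplus> a \<oplus> b \<oplus> t \<odot> c \<oplus> \<one> =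
    a \<otimes> b \<otimes> a \<oplus> a \<otimes> b \<oplus> b \<otimes> a \<oplus> a \<oplus> b \<oplus> \<one>"
proof -
  have "a \<otimes> b \<otimes> a = c \<otimes> (a \<otimes> a)"
    using assms(1-3) ca by (metis m_assoc)
  also have "\<dots> = (t - 1) \<odot> (c \<otimes> a) \<oplus> t \<odot> c"
    unfolding quad using assms(1-3) by (simp add: r_distr smult_mult_right)
  also have "\<dots> = t \<odot> (a \<otimes> b) \<ominus> a \<otimes> b \<oplus> t \<odot> c"
    unfolding ca using assms(1,2) by (simp add: smult_diff_one)
  finally have aba: "a \<otimes> b \<otimes> a = t \<odot> (a \<otimes> b) \<ominus> a \<otimes> b \<oplus> t \<odot> c" .
  have "t \<odot> (a \<otimes> b) \<in> carrier A" "t \<odot> c \<in> carrier A" using assms by simp_all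
  then show ?thesis unfolding aba using assms(1-3) by algebra
qed

section \<open>Conjugation by units as an algebra automorphism\<close>

definition conj_by :: "'a \<Rightarrow> 'a \<Rightarrow> 'a"
  where "conj_by u x = u \<otimes> x \<otimes> inv u"

lemma conj_by_closed [simp]: "u \<in> Units A \<Longrightarrow> x \<in> carrier A \<Longrightarrow> conj_by u x \<in> carrier A"
  by (simp add: conj_by_def Units_closed)

lemma conj_by_mult:
  assumes "u \<in> Units A" "x \<in> carrier A" "y \<in> carrier A"
  shows "conj_by u (x \<otimes> y) = conj_by u x \<otimes> conj_by u y"
proof -
  have "conj_by u x \<otimes> conj_by u y = u \<otimes> x \<otimes> (inv u \<otimes> u) \<otimes> (y \<otimes> inv u)"
    using assms unfolding conj_by_def by (simp add: Units_closed m_assoc del: Units_l_inv)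
  then show ?thesis
    using assms by (simp add: conj_by_def Units_closed m_assoc)
qed

lemma conj_by_add:
  "u \<in> Units A \<Longrightarrow> x \<in> carrier A \<Longrightarrow> y \<in> carrier A \<Longrightarrow> conj_by u (x \<oplus> y) = conj_by u x \<oplus> conj_by u y"
  by (simp add: conj_by_def Units_closed l_distr r_distr)

lemma conj_by_smult: "u \<in> Units A \<Longrightarrow> x \<in> carrier A \<Longrightarrow> conj_by u (c \<odot> x) = c \<odot> conj_by u x"
  by (simp add: conj_by_def Units_closed smult_mult_left smult_mult_right)

lemma conj_by_one: "u \<in> Units A \<Longrightarrow> conj_by u \<one> = \<one>"
  by (simp add: conj_by_def Units_closed)

lemma conj_by_zero: "u \<in> Units A \<Longrightarrow> conj_by u \<zero> = \<zero>"
  by (simp add: conj_by_def Units_closed)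

lemma conj_by_one_left: "x \<in> carrier A \<Longrightarrow> conj_by \<one> x = x"
  by (simp add: conj_by_def)

lemma inv_mult_Units:
  assumes "u \<in> Units A" "v \<in> Units A"
  shows "inv (u \<otimes> v) = inv v \<otimes> inv u"
proof (rule inv_char[OF Units_closed])
  have cl: "u \<in> carrier A" "v \<in> carrier A" "inv u \<in> carrier A" "inv v \<in> carrier A"
    using assms by auto
  have "u \<otimes> v \<otimes> (inv v \<otimes> inv u) = u \<otimes> (v \<otimes> inv v) \<otimes> inv u"
    using cl by (simp add: m_assoc del: Units_r_inv)
  then show "u \<otimes> v \<otimes> (inv v \<otimes> inv u) = \<one>" using assms cl by simp
  have "inv v \<otimes> inv u \<otimes> (u \<otimes> v) = inv v \<otimes> (inv u \<otimes> u) \<otimes> v"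
    using cl by (simp add: m_assoc del: Units_l_inv)
  then show "inv v \<otimes> inv u \<otimes> (u \<otimes> v) = \<one>" using assms cl by simp
qed (use assms in auto)

lemma conj_by_conj_by:
  "u \<in> Units A \<Longrightarrow> v \<in> Units A \<Longrightarrow> x \<in> carrier A \<Longrightarrow> conj_by u (conj_by v x) = conj_by (u \<otimes> v) x"
  by (simp add: conj_by_def inv_mult_Units Units_closed m_assoc)

text \<open>Reading commutation as being fixed under conjugation lets commutation arguments be
  carried out by composing conjugations with \<open>conj_by_conj_by\<close>.\<close>

lemma conj_by_fixed_iff:
  assumes "u \<in> Units A" "x \<in> carrier A"
  shows "conj_by u x = x \<longleftrightarrow> x \<otimes> u = u \<otimes> x"
proof
  assume "conj_by u x = x"
  then have "x \<otimes> u = conj_by u x \<otimes> u" by simp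
  also have "\<dots> = u \<otimes> x"
    using assms by (simp add: conj_by_def Units_closed m_assoc)
  finally show "x \<otimes> u = u \<otimes> x" .
next
  assume eq: "x \<otimes> u = u \<otimes> x"
  have "conj_by u x = x \<otimes> u \<otimes> inv u" by (simp add: conj_by_def eq)
  then show "conj_by u x = x"
    using assms by (simp add: Units_closed m_assoc)
qed

text \<open>As \<open>x\<close> and \<open>u\<close> commute, so do the conjugations by them; hence
  conjugation by \<open>x\<close> fixes \<open>conj_by u y\<close> as soon as it fixes
  \<open>y\<close>.\<close>

lemma commute_conj_by:
  assumes u: "u \<in> Units A" and x: "x \<in> Units A" "x \<otimes> u = u \<otimes> x"
    and y: "y \<in> carrier A" "x \<otimes> y = y \<otimes> x"
  shows "x \<otimes> conj_by u y = conj_by u y \<otimes> x"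
proof -
  have "conj_by x (conj_by u y) = conj_by u (conj_by x y)"
    using u x y by (simp add: conj_by_conj_by)
  also have "conj_by x y = y" using conj_by_fixed_iff[of x y] x y by simp
  finally show ?thesis using conj_by_fixed_iff[of x "conj_by u y"] u x y by simp
qed

lemma conj_by_Units:
  assumes "u \<in> Units A" "x \<in> Units A" shows "conj_by u x \<in> Units A"
  unfolding conj_by_def using assms by simp

end

text \<open>The two orientations of the cubic relation share all terms of degree below three;
  cancelling them leaves the braid relation.\<close>

lemma (in complex_algebra) cubic_relations_imp_braid:
  assumes "a \<in> carrier A" "b \<in> carrier A"
    and "a \<otimes> b \<otimes> a \<oplus> a \<otimes> b \<oplus> b \<otimes> a \<oplus> a \<oplus> b \<oplus> \<one> = \<zero>"
    and "b \<otimes> a \<otimes> b \<oplus> b \<otimes> a \<oplus> a \<otimes> b \<oplus> b \<oplus> a \<oplus> \<one> = \<zero>"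
  shows "a \<otimes> b \<otimes> a = b \<otimes> a \<otimes> b"
proof -
  let ?r = "a \<otimes> b \<oplus> b \<otimes> a \<oplus> a \<oplus> b \<oplus> \<one>"
  have "a \<otimes> b \<otimes> a \<oplus> ?r = \<zero>" "b \<otimes> a \<otimes> b \<oplus> ?r = \<zero>"
    using assms by (simp_all add: a_ac)
  then show ?thesis
    using assms(1,2) add.right_cancel[of ?r "a \<otimes> b \<otimes> a" "b \<otimes> a \<otimes> b"] by simp
qed

lemma (in complex_algebra) minus_self: "x \<in> carrier A \<Longrightarrow> x \<ominus> x = \<zero>"
  by (simp add: a_minus_def r_neg)

lemma (in complex_algebra) UnitsI_inv:
  assumes "x \<in> carrier A" "y \<in> carrier A" "x \<otimes> y = \<one>" "y \<otimes> x = \<one>"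
  shows "x \<in> Units A" "inv x = y"
  using assms inv_char[of x y] by (auto simp: Units_def)

text \<open>The calculus of bands uses nothing about \<open>TL\<close> beyond these relations. The
  cubic one has the upper neighbour as outer factor because the upper generator takes the place of
  \<open>a\<close> in \<open>band_relation_eq_cubic_relation\<close>.\<close>

locale TL_generators = complex_algebra A for A :: "(complex, 'a) module" (structure) +
  fixes n :: nat and t :: complex and h :: "nat \<Rightarrow> 'a"
  assumes h_Units: "1 \<le> i \<Longrightarrow> i < n \<Longrightarrow> h i \<in> Units A"
    and h_commute: "1 \<le> i \<Longrightarrow> i + 1 < j \<Longrightarrow> j < n \<Longrightarrow> h i \<otimes> h j = h j \<otimes> h i"
    and h_braid: "1 \<le> i \<Longrightarrow> i + 1 < n \<Longrightarrow> h i \<otimes> h (i + 1) \<otimes> h i = h (i + 1) \<otimes> h i \<otimes> h (i + 1)"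
    and h_quadratic: "1 \<le> i \<Longrightarrow> i < n \<Longrightarrow> h i \<otimes> h i = (t - 1) \<odot> h i \<oplus> t \<odot> \<one>"
    and h_cubic: "1 \<le> i \<Longrightarrow> i + 1 < n \<Longrightarrow>
      h (i + 1) \<otimes> h i \<otimes> h (i + 1) \<oplus> h (i + 1) \<otimes> h i \<oplus> h i \<otimes> h (i + 1) \<oplus> h (i + 1) \<oplus> h i \<oplus> \<one> = \<zero>"
begin

definition band :: "nat \<Rightarrow> nat \<Rightarrow> 'a"
  where "band j i = list_product A (map h (rev [i..<j])) \<otimes>
    list_product A (map (\<lambda>m. inv (h m)) [i+1..<j])"

lemma h_closed [simp]: "1 \<le> i \<Longrightarrow> i < n \<Longrightarrow> h i \<in> carrier A"
  using h_Units Units_closed by blast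

lemma band_Suc_self: "1 \<le> i \<Longrightarrow> i < n \<Longrightarrow> band (Suc i) i = h i"
  by (simp add: band_def list_product_def)

text \<open>Raising the upper end puts \<open>h j\<close> in front and its inverse at the back. For
  \<open>i = j\<close> the list of inverses would stay empty, so inductions start one step later, at
  \<open>band_Suc_self\<close>.\<close>

lemma band_Suc:
  assumes "1 \<le> i" "i < j" "j < n"
  shows "band (Suc j) i = conj_by (h j) (band j i)"
proof -
  have "set (map (\<lambda>m. inv (h m)) [i+1..<Suc j]) \<subseteq> carrier A"
    and 1: "set (map h (rev [i..<j])) \<subseteq> carrier A"
    using assms h_Units by auto
  then have 2: "set (map (\<lambda>m. inv (h m)) [i+1..<j]) \<subseteq> carrier A" and 3: "inv (h j) \<in> carrier A"
    using assms by auto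
  have "band (Suc j) i = h j \<otimes> list_product A (map h (rev [i..<j])) \<otimes>
      list_product A (map (\<lambda>m. inv (h m)) [i+1..<j] @ [inv (h j)])"
    using assms by (simp add: band_def list_product_def)
  also have "list_product A (map (\<lambda>m. inv (h m)) [i+1..<j] @ [inv (h j)]) =
      list_product A (map (\<lambda>m. inv (h m)) [i+1..<j]) \<otimes> inv (h j)"
    using list_product_append[OF 2, of "[inv (h j)]"] 3 by (simp add: list_product_def)
  finally show ?thesis
    using assms list_product_closed[OF 1] list_product_closed[OF 2] 3
    by (simp add: conj_by_def band_def m_assoc)
qed

lemma band_Units:
  assumes "1 \<le> i" "i < j" "j \<le> n"
  shows "band j i \<in> Units A"
proof -
  have "Suc i \<le> j" using assms by simp
  then show ?thesis using assms(3)
    by (induction j rule: dec_induct)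
      (use assms h_Units in \<open>auto simp: band_Suc_self band_Suc conj_by_Units\<close>)
qed

lemma band_closed [simp]: "1 \<le> i \<Longrightarrow> i < j \<Longrightarrow> j \<le> n \<Longrightarrow> band j i \<in> carrier A"
  using band_Units Units_closed by blast

section \<open>Commutation of bands\<close>

lemma h_commute_far:
  "1 \<le> i \<Longrightarrow> i < n \<Longrightarrow> 1 \<le> j \<Longrightarrow> j < n \<Longrightarrow> i + 1 < j \<or> j + 1 < i \<Longrightarrow> h i \<otimes> h j = h j \<otimes> h i"
  using h_commute[of i j] h_commute[of j i] by auto

lemma commute_band:
  assumes "x \<in> Units A" "1 \<le> i" "i < j" "j \<le> n"
    and "\<And>m. i \<le> m \<Longrightarrow> m < j \<Longrightarrow> x \<otimes> h m = h m \<otimes> x"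
  shows "x \<otimes> band j i = band j i \<otimes> x"
proof -
  have "Suc i \<le> j" using assms by simp
  then show ?thesis using assms(4,5)
    by (induction j rule: dec_induct)
      (use assms(1,2) in \<open>auto simp: band_Suc_self band_Suc h_Units intro!: commute_conj_by\<close>)
qed

lemma h_commute_band_outside:
  assumes "1 \<le> m" "m < n" "1 \<le> i" "i < j" "j \<le> n" "m + 1 < i \<or> j < m"
  shows "h m \<otimes> band j i = band j i \<otimes> h m"
  using assms by (intro commute_band h_Units h_commute_far) auto

text \<open>Letter by letter commutation fails, since the word contains neighbours of
  \<open>h m\<close>. For \<open>j = m + 2\<close> the braid relation gives
  \<open>h m (h (m+1) h m) = (h (m+1) h m) h (m+1)\<close>: what passes through comes out as
  \<open>h (m+1)\<close>, which commutes with \<open>band m i\<close>. All later conjugations are by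
  some \<open>h j\<close> that commutes with \<open>h m\<close>.\<close>

lemma h_commute_band_inside:
  assumes "1 \<le> i" "i < m" "m + 1 < j" "j \<le> n"
  shows "h m \<otimes> band j i = band j i \<otimes> h m"
proof -
  have "m + 2 \<le> j" using assms by simp
  then show ?thesis using assms(4)
  proof (induction j rule: dec_induct)
    case base
    let ?a = "h m" and ?b = "h (m + 1)" and ?x = "band m i"
    have cl: "?a \<in> Units A" "?b \<in> Units A" "?x \<in> carrier A"
      using assms base by (auto intro: h_Units)
    have fix_x: "conj_by ?b ?x = ?x"
      using cl h_commute_band_outside[of "m + 1" i m] assms base
      by (subst conj_by_fixed_iff) auto
    have "band (m + 2) i = conj_by ?b (conj_by ?a ?x)"
      using band_Suc[of i m] band_Suc[of i "m + 1"] assms base by simp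
    then have eq: "band (m + 2) i = conj_by (?b \<otimes> ?a) ?x" using cl by (simp add: conj_by_conj_by)
    then have "conj_by ?a (band (m + 2) i) = conj_by (?a \<otimes> ?b \<otimes> ?a) ?x"
      using cl by (simp add: conj_by_conj_by m_assoc Units_closed)
    also have "\<dots> = conj_by (?b \<otimes> ?a) (conj_by ?b ?x)"
      using cl h_braid[of m] assms base by (simp add: conj_by_conj_by)
    also have "\<dots> = band (m + 2) i" using eq fix_x by simp
    finally show ?case
      using conj_by_fixed_iff[OF cl(1), of "band (m + 2) i"] assms base by simp
  next
    case (step j)
    then show ?case
      using assms by (auto simp: band_Suc intro!: commute_conj_by h_Units h_commute)
  qed
qed

lemma band_commute_disjoint:
  assumes "1 \<le> k" "k < l" "l < i" "i < j" "j \<le> n"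
  shows "band l k \<otimes> band j i = band j i \<otimes> band l k"
proof (rule sym, rule commute_band)
  fix m assume "k \<le> m" "m < l"
  then show "band j i \<otimes> h m = h m \<otimes> band j i"
    using h_commute_band_outside[of m i j] assms by simp
qed (use assms in \<open>auto intro: band_Units\<close>)

lemma band_commute_nested:
  assumes "1 \<le> i" "i < k" "k < l" "l < j" "j \<le> n"
  shows "band l k \<otimes> band j i = band j i \<otimes> band l k"
proof (rule sym, rule commute_band)
  fix m assume "k \<le> m" "m < l"
  then show "band j i \<otimes> h m = h m \<otimes> band j i"
    using h_commute_band_inside[of i m j] assms by simp
qed (use assms in \<open>auto intro: band_Units\<close>)

text \<open>A positive product means that \<open>{k, l}\<close> and \<open>{i, j}\<close>, seen as
  chords of a circle, neither cross nor share an endpoint. The intervals are then disjoint or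
  strictly nested.\<close>

lemma band_commute:
  assumes "1 \<le> k" "k < l" "l \<le> n" "1 \<le> i" "i < j" "j \<le> n"
    and "(int l - int j) * (int l - int i) * (int k - int j) * (int k - int i) > 0"
  shows "band l k \<otimes> band j i = band j i \<otimes> band l k"
proof -
  consider "l < i" | "j < k" | "i < k" "l < j" | "k < i" "j < l"
  proof -
    \<comment> \<open>The weak inequalities here and in the mirror case below also rule out every
      shared endpoint.\<close>
    have "\<not> (k \<le> i \<and> i \<le> l \<and> l \<le> j)"
    proof
      assume "k \<le> i \<and> i \<le> l \<and> l \<le> j"
      then have "(int l - int j) * (int l - int i) \<le> 0" "(int k - int j) * (int k - int i) \<ge> 0"
        using assms by (auto intro: mult_nonpos_nonneg mult_nonpos_nonpos)
      from mult_nonpos_nonneg[OF this] show False using assms(7) by (simp add: mult.assoc)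
    qed
    moreover have "\<not> (i \<le> k \<and> k \<le> j \<and> j \<le> l)"
    proof
      assume "i \<le> k \<and> k \<le> j \<and> j \<le> l"
      then have "(int l - int j) * (int l - int i) \<ge> 0" "(int k - int j) * (int k - int i) \<le> 0"
        using assms by (auto intro: mult_nonpos_nonneg)
      from mult_nonneg_nonpos[OF this] show False using assms(7) by (simp add: mult.assoc)
    qed
    ultimately show ?thesis using that assms by linarith
  qed
  then show ?thesis
  proof cases
    case 1
    then show ?thesis using assms by (intro band_commute_disjoint)
  next
    case 2
    then show ?thesis using assms by (intro band_commute_disjoint[symmetric])
  next
    case 3
    then show ?thesis using assms by (intro band_commute_nested)
  next
    case 4
    then show ?thesis using assms by (intro band_commute_nested[symmetric])
  qed
qed

section \<open>Moving the lower end, and relations within a triple\<close>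

lemma band_lower_end:
  assumes "1 \<le> i" "i + 1 < j" "j \<le> n"
  shows "band j i = conj_by (inv (h i)) (band j (i + 1))"
proof -
  have "i + 2 \<le> j" using assms by simp
  then show ?thesis using assms(3)
  proof (induction j rule: dec_induct)
    case base
    let ?a = "h i" and ?b = "h (i + 1)"
    have u: "?a \<in> Units A" "?b \<in> Units A" using assms base by (auto intro: h_Units)
    \<comment> \<open>With \<open>a = h i\<close> and \<open>b = h (i+1)\<close> the braid relation
      is rewritten as \<open>b a b^-1 = a^-1 b a\<close>, which exchanges growth at the top for
      growth at the bottom.\<close>
    have "band (i + 2) i = ?b \<otimes> ?a \<otimes> inv ?b"
      using band_Suc[of i "i + 1"] band_Suc_self[of i] assms base by (simp add: conj_by_def)
    also have "\<dots> = (inv ?a \<otimes> ?a) \<otimes> ?b \<otimes> ?a \<otimes> inv ?b"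
      using u by (simp add: Units_closed)
    also have "\<dots> = inv ?a \<otimes> (?a \<otimes> ?b \<otimes> ?a) \<otimes> inv ?b"
      using u by (simp add: Units_closed m_assoc del: Units_l_inv)
    also have "\<dots> = inv ?a \<otimes> (?b \<otimes> ?a \<otimes> ?b) \<otimes> inv ?b"
      using h_braid[of i] assms base by simp
    also have "\<dots> = inv ?a \<otimes> ?b \<otimes> ?a"
      using u by (simp add: Units_closed m_assoc)
    also have "\<dots> = conj_by (inv ?a) (band (i + 2) (i + 1))"
      using u band_Suc_self[of "i + 1"] assms base by (simp add: conj_by_def)
    finally show ?case .
  next
    case (step j)
    then have u: "h i \<in> Units A" "h j \<in> Units A" using assms by (auto intro: h_Units)
    have "conj_by (h j) (inv (h i)) = inv (h i)"
    proof -
      have "conj_by (h j) (h i) = h i"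
        using u h_commute[of i j] step assms by (subst conj_by_fixed_iff) auto
      moreover have "inv (conj_by (h j) (h i)) = conj_by (h j) (inv (h i))"
        using u by (simp add: conj_by_def inv_mult_Units m_assoc Units_closed)
      ultimately show ?thesis by simp
    qed
    then have comm: "inv (h i) \<otimes> h j = h j \<otimes> inv (h i)"
      using u conj_by_fixed_iff[of "h j" "inv (h i)"] by simp
    have "band (Suc j) i = conj_by (h j) (conj_by (inv (h i)) (band j (i + 1)))"
      using band_Suc[of i j] step assms by simp
    also have "\<dots> = conj_by (inv (h i)) (conj_by (h j) (band j (i + 1)))"
      using u comm step assms by (simp add: conj_by_conj_by)
    also have "conj_by (h j) (band j (i + 1)) = band (Suc j) (i + 1)"
      using band_Suc[of "i + 1" j] step assms by simp
    finally show ?case .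
  qed
qed

lemma inv_h_commute:
  assumes "1 \<le> i" "i + 1 < j" "j < n"
  shows "h j \<otimes> inv (h i) = inv (h i) \<otimes> h j"
proof -
  have u: "h i \<in> Units A" "h j \<in> Units A" using assms by (auto intro: h_Units)
  have "conj_by (h i) (h j) = h j"
    using u h_commute[of i j] assms by (subst conj_by_fixed_iff) auto
  then have "conj_by (inv (h i)) (h j) = h j"
    using u conj_by_conj_by[of "inv (h i)" "h i" "h j"] by (simp add: conj_by_one_left Units_closed)
  then show ?thesis using u by (subst (asm) conj_by_fixed_iff) auto
qed

text \<open>
  The relations among \<open>band j i\<close>, \<open>band k j\<close>, \<open>band k i\<close> reduce to those among consecutive
  generators, because a single conjugation carries one triple to the other.
\<close>

lemma band_triple_conjugate_consecutive:
  assumes "1 \<le> i" "i \<le> p" "Suc p < k" "k \<le> n"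
  shows "\<exists>u\<in>Units A. band (Suc p) i = conj_by u (h p) \<and> band k (Suc p) = conj_by u (h (Suc p)) \<and>
    band k i = conj_by u (conj_by (h (Suc p)) (h p))"
proof -
  \<comment> \<open>The second conjunct is what makes one unit serve the whole triple:
    \<open>u\<close> must lower the first band without disturbing \<open>h (Suc p)\<close>. It
    survives each step because \<open>inv (h i)\<close> with \<open>i < p\<close> commutes with
    \<open>h (Suc p)\<close>, and it lets the two conjugations in the base case below be
    exchanged.\<close>
  have lower: "\<exists>u\<in>Units A. band (Suc p) i = conj_by u (h p) \<and> conj_by u (h (Suc p)) = h (Suc p)"
    using assms(2,1)
  proof (induction i rule: inc_induct)
    case base
    then show ?case
      using assms by (intro bexI[of _ "\<one>"]) (simp_all add: band_Suc_self conj_by_one_left)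
  next
    case (step i)
    then obtain u where u: "u \<in> Units A" "band (Suc p) (Suc i) = conj_by u (h p)"
      "conj_by u (h (Suc p)) = h (Suc p)" by auto
    have hi: "inv (h i) \<in> Units A" using h_Units[of i] step assms by simp
    show ?case
    proof (intro bexI[of _ "inv (h i) \<otimes> u"] conjI)
      show "band (Suc p) i = conj_by (inv (h i) \<otimes> u) (h p)"
        using band_lower_end[of i "Suc p"] u hi step assms by (simp add: conj_by_conj_by)
      have "conj_by (inv (h i)) (h (Suc p)) = h (Suc p)"
        using hi inv_h_commute[of i "Suc p"] step assms by (subst conj_by_fixed_iff) auto
      then show "conj_by (inv (h i) \<otimes> u) (h (Suc p)) = h (Suc p)"
        using u hi assms by (simp add: conj_by_conj_by[symmetric])
    qed (use u hi in auto)
  qed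
  have "Suc (Suc p) \<le> k" using assms by simp
  then show ?thesis using assms(4)
  proof (induction k rule: dec_induct)
    case base
    obtain u where u: "u \<in> Units A" "band (Suc p) i = conj_by u (h p)"
      "conj_by u (h (Suc p)) = h (Suc p)" using lower by auto
    have b: "h (Suc p) \<in> Units A" "h p \<in> carrier A" using assms base by (auto intro: h_Units)
    have "band (Suc (Suc p)) i = conj_by (h (Suc p)) (conj_by u (h p))"
      using band_Suc[of i "Suc p"] u assms base by simp
    also have "\<dots> = conj_by u (conj_by (h (Suc p)) (h p))"
    proof -
      have "h (Suc p) \<otimes> u = u \<otimes> h (Suc p)"
        using u(1,3) b conj_by_fixed_iff[of u "h (Suc p)"] by (simp add: Units_closed)
      then show ?thesis using u b by (simp add: conj_by_conj_by)
    qed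
    finally show ?case
      using u band_Suc_self[of "Suc p"] base by auto
  next
    case (step k)
    then obtain u where u: "u \<in> Units A" "band (Suc p) i = conj_by u (h p)"
      "band k (Suc p) = conj_by u (h (Suc p))"
      "band k i = conj_by u (conj_by (h (Suc p)) (h p))" by auto
    have hk: "h k \<in> Units A" and hp: "h p \<in> carrier A" "h (Suc p) \<in> Units A"
      using step assms by (auto intro: h_Units)
    \<comment> \<open>Raising \<open>k\<close> changes two of the three bands; the third ends at
      \<open>Suc p < k\<close> and is fixed by \<open>h k\<close>, so all three may be conjugated
      together.\<close>
    have "conj_by (h k) (band (Suc p) i) = band (Suc p) i"
      using hk h_commute_band_outside[of k i "Suc p"] step assms
      by (subst conj_by_fixed_iff) auto
    then have "band (Suc p) i = conj_by (h k \<otimes> u) (h p)"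
      using u hk hp by (simp add: conj_by_conj_by)
    moreover have "band (Suc k) (Suc p) = conj_by (h k \<otimes> u) (h (Suc p))"
      using band_Suc[of "Suc p" k] u hk hp step assms by (simp add: conj_by_conj_by Units_closed)
    moreover have "band (Suc k) i = conj_by (h k \<otimes> u) (conj_by (h (Suc p)) (h p))"
      using band_Suc[of i k] u hk hp step assms
      by (simp add: conj_by_conj_by[of "h k" u, symmetric])
    ultimately show ?case using u hk by (intro bexI[of _ "h k \<otimes> u"]) auto
  qed
qed

lemma band_quadratic:
  assumes "1 \<le> i" "i < j" "j \<le> n"
  shows "band j i \<otimes> band j i = (t - 1) \<odot> band j i \<oplus> t \<odot> \<one>"
proof -
  have "Suc i \<le> j" using assms by simp
  then show ?thesis using assms(3)
  proof (induction j rule: dec_induct)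
    case base
    then show ?case using assms by (simp add: band_Suc_self h_quadratic)
  next
    case (step j)
    have u: "h j \<in> Units A" and cl: "band j i \<in> carrier A"
      and b: "band (Suc j) i = conj_by (h j) (band j i)"
      using step.hyps step.prems assms by (auto intro: h_Units band_closed simp: band_Suc)
    have "band (Suc j) i \<otimes> band (Suc j) i = conj_by (h j) (band j i \<otimes> band j i)"
      unfolding b using u cl by (simp only: conj_by_mult)
    also have "\<dots> = conj_by (h j) ((t - 1) \<odot> band j i \<oplus> t \<odot> \<one>)"
      using step.IH step.prems by simp
    also have "\<dots> = (t - 1) \<odot> band (Suc j) i \<oplus> t \<odot> \<one>"
      unfolding b using u cl by (simp add: conj_by_add conj_by_smult conj_by_one)
    finally show ?case .
  qed
qed

lemma band_triple_relations:
  assumes "1 \<le> i" "i < j" "j < k" "k \<le> n"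
  shows "band k j \<otimes> band j i = band j i \<otimes> band k i"
    and "band j i \<otimes> band k i = band k i \<otimes> band k j"
    and "band j i \<otimes> band k j \<oplus> t \<odot> (band k j \<otimes> band j i) \<oplus> band k j \<oplus> band j i \<oplus> t \<odot> band k i \<oplus> \<one>
      = \<zero>"
proof -
  obtain p where p: "j = Suc p" using assms by (cases j) auto
  let ?a = "h (Suc p)" and ?b = "h p" and ?c = "conj_by (h (Suc p)) (h p)"
  obtain u where u: "u \<in> Units A"
    and g: "band j i = conj_by u ?b" "band k j = conj_by u ?a" "band k i = conj_by u ?c"
    using band_triple_conjugate_consecutive[of i p k] assms p by auto
  have U: "?a \<in> Units A" and cl: "?a \<in> carrier A" "?b \<in> carrier A" "?c \<in> carrier A"
    using assms p by (auto intro!: h_Units conj_by_closed)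
  have ca: "?c \<otimes> ?a = ?a \<otimes> ?b"
    using U cl by (simp add: conj_by_def m_assoc)
  \<comment> \<open>While \<open>c a = a b\<close> is mere cancellation, the equality
    \<open>b c = a b\<close> is the braid relation multiplied by \<open>inv a\<close> on the
    right.\<close>
  have "?b \<otimes> ?c = (?b \<otimes> ?a \<otimes> ?b) \<otimes> inv ?a"
    using U cl by (simp add: conj_by_def m_assoc)
  also have "\<dots> = (?a \<otimes> ?b \<otimes> ?a) \<otimes> inv ?a"
    using h_braid[of p] assms p by simp
  also have "\<dots> = ?a \<otimes> ?b"
    using U cl by (simp add: m_assoc)
  finally have bc: "?b \<otimes> ?c = ?a \<otimes> ?b" .
  show "band k j \<otimes> band j i = band j i \<otimes> band k i"
    unfolding g using u cl bc by (simp flip: conj_by_mult)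
  show "band j i \<otimes> band k i = band k i \<otimes> band k j"
    unfolding g using u cl bc ca by (simp flip: conj_by_mult)
  have "?b \<otimes> ?a \<oplus> t \<odot> (?a \<otimes> ?b) \<oplus> ?a \<oplus> ?b \<oplus> t \<odot> ?c \<oplus> \<one> = \<zero>"
    using band_relation_eq_cubic_relation[OF cl h_quadratic ca] h_cubic[of p] assms p by simp
  then have "conj_by u (?b \<otimes> ?a \<oplus> t \<odot> (?a \<otimes> ?b) \<oplus> ?a \<oplus> ?b \<oplus> t \<odot> ?c \<oplus> \<one>) = \<zero>"
    using u by (simp add: conj_by_zero)
  then show "band j i \<otimes> band k j \<oplus> t \<odot> (band k j \<otimes> band j i) \<oplus> band k j \<oplus> band j i \<oplus>
      t \<odot> band k i \<oplus> \<one> = \<zero>"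
    unfolding g using u cl by (simp add: conj_by_add conj_by_mult conj_by_smult conj_by_one)
qed

end

section \<open>The two presentations of the Temperley--Lieb algebra\<close>

locale TL_parameters =
  fixes n :: nat and \<tau> t :: complex
  assumes tau_nonzero: "\<tau> \<noteq> 0" and t_nonzero: "t \<noteq> 0"
    and inverse_tau: "inverse \<tau> = 2 + t + inverse t"
begin

abbreviation band_index :: "(nat \<times> nat) with_inverse set"
  where "band_index \<equiv> inverse_gens (g_index n)"

abbreviation band_relations :: "(nat \<times> nat) with_inverse nc_poly set"
  where "band_relations \<equiv> g_relations n t \<union> inverse_relations (g_index n)"

abbreviation band_algebra :: "(complex, (nat \<times> nat) with_inverse nc_poly set) module"
  where "band_algebra \<equiv> inv_presented_algebra (g_index n) (g_relations n t)"

abbreviation \<gamma> :: "nat \<Rightarrow> nat \<Rightarrow> (nat \<times> nat) with_inverse nc_poly set"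
  where "\<gamma> j i \<equiv> inv_presented_gen (g_index n) (g_relations n t) (j, i)"

text \<open>Multiplying the hypothesis by \<open>t\<close> gives
  \<open>t / \<tau> = (t + 1)^2\<close>, so \<open>t = -1\<close> would force
  \<open>t = 0\<close>.\<close>

lemma tau_eq: "\<tau> * (t + 1)\<^sup>2 = t" and t_plus_one_nonzero: "t + 1 \<noteq> 0"
proof -
  have "t * inverse \<tau> = (t + 1)\<^sup>2"
    unfolding inverse_tau using t_nonzero by (simp add: algebra_simps power2_eq_square)
  then show "\<tau> * (t + 1)\<^sup>2 = t" using tau_nonzero by (simp add: field_simps)
  then show "t + 1 \<noteq> 0" using t_nonzero by auto
qed

lemma g_gen_carrier:
  "1 \<le> i \<Longrightarrow> i < j \<Longrightarrow> j \<le> n \<Longrightarrow> g_gen j i \<in> carrier (free_algebra band_index)"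
  by (intro carrier_free_algebra_gen) (auto simp: inverse_gens_def g_index_def)

lemma inverse_gen_carrier:
  "x \<in> g_index n \<Longrightarrow> gen (Gen x) \<in> carrier (free_algebra band_index)"
  "x \<in> g_index n \<Longrightarrow> gen (Gen_inv x) \<in> carrier (free_algebra band_index)"
  by (auto intro!: carrier_free_algebra_gen simp: inverse_gens_def)

sublocale TL: presentation "{1..<n}" "TL_relations n \<tau>"
  rewrites "presented_algebra {1..<n} (TL_relations n \<tau>) = TL n \<tau>"
    and "presented_gen {1..<n} (TL_relations n \<tau>) = TL_e n \<tau>"
proof -
  show "presentation {1..<n} (TL_relations n \<tau>)"
    by standard (auto simp: TL_relations_def
      intro!: carrier_free_algebra_intros carrier_free_algebra_diff)
qed (simp_all add: TL_def TL_e_def[abs_def])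

text \<open>Formal inverses are ordinary letters with two extra families of relations, so the
  algebra with invertible generators is again an instance of \<open>presentation\<close>.\<close>

sublocale band: presentation band_index band_relations
  rewrites "presented_algebra band_index band_relations = band_algebra"
proof -
  show "presentation band_index band_relations"
    by standard (auto simp: g_relations_def inverse_relations_def inverse_gens_def g_index_def
      intro!: carrier_free_algebra_intros carrier_free_algebra_diff)
qed (simp add: inv_presented_algebra_def)

lemma gen_TL_carrier: "1 \<le> i \<Longrightarrow> i < n \<Longrightarrow> gen i \<in> carrier (free_algebra {1..<n})"
  by (simp add: carrier_free_algebra_gen)

lemma TL_e_closed: "1 \<le> i \<Longrightarrow> i < n \<Longrightarrow> TL_e n \<tau> i \<in> carrier (TL n \<tau>)"
  using TL.gen_closed[of i] by simp

lemma TL_e_relations: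
  "1 \<le> i \<Longrightarrow> i < n \<Longrightarrow> TL_e n \<tau> i \<otimes>\<^bsub>TL n \<tau>\<^esub> TL_e n \<tau> i = TL_e n \<tau> i"
  "1 \<le> i \<Longrightarrow> i + 1 < j \<Longrightarrow> j < n \<Longrightarrow>
    TL_e n \<tau> i \<otimes>\<^bsub>TL n \<tau>\<^esub> TL_e n \<tau> j = TL_e n \<tau> j \<otimes>\<^bsub>TL n \<tau>\<^esub> TL_e n \<tau> i"
  "1 \<le> i \<Longrightarrow> i < n \<Longrightarrow> 1 \<le> j \<Longrightarrow> j < n \<Longrightarrow> j = i + 1 \<or> i = j + 1 \<Longrightarrow>
    TL_e n \<tau> i \<otimes>\<^bsub>TL n \<tau>\<^esub> TL_e n \<tau> j \<otimes>\<^bsub>TL n \<tau>\<^esub> TL_e n \<tau> i = \<tau> \<odot>\<^bsub>TL n \<tau>\<^esub> TL_e n \<tau> i"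
proof -
  assume "1 \<le> i" "i < n"
  then have "TL.cls (gen i * gen i) = TL.cls (gen i)"
    by (intro TL.cls_relation_eq carrier_free_algebra_intros) (auto simp: TL_relations_def)
  then show "TL_e n \<tau> i \<otimes>\<^bsub>TL n \<tau>\<^esub> TL_e n \<tau> i = TL_e n \<tau> i"
    using gen_TL_carrier \<open>1 \<le> i\<close> \<open>i < n\<close> by (simp add: TL.cls_simps TL.cls_gen del: One_nat_def)
next
  assume ij: "1 \<le> i" "i + 1 < j" "j < n"
  then have "gen i * gen j - gen j * gen i \<in> TL_relations n \<tau>"
    unfolding TL_relations_def by (intro UnI1 CollectI exI[of _ i] exI[of _ j]) auto
  then have "TL.cls (gen i * gen j) = TL.cls (gen j * gen i)"
    using ij by (intro TL.cls_relation_eq carrier_free_algebra_intros) auto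
  then show "TL_e n \<tau> i \<otimes>\<^bsub>TL n \<tau>\<^esub> TL_e n \<tau> j = TL_e n \<tau> j \<otimes>\<^bsub>TL n \<tau>\<^esub> TL_e n \<tau> i"
    using gen_TL_carrier ij by (simp add: TL.cls_simps TL.cls_gen del: One_nat_def)
next
  assume ij: "1 \<le> i" "i < n" "1 \<le> j" "j < n" "j = i + 1 \<or> i = j + 1"
  then have "gen i * gen j * gen i - scale \<tau> (gen i) \<in> TL_relations n \<tau>"
    unfolding TL_relations_def by (intro UnI2 CollectI exI[of _ i] exI[of _ j]) auto
  then have "TL.cls (gen i * gen j * gen i) = TL.cls (scale \<tau> (gen i))"
    using ij by (intro TL.cls_relation_eq carrier_free_algebra_intros) auto
  then show "TL_e n \<tau> i \<otimes>\<^bsub>TL n \<tau>\<^esub> TL_e n \<tau> j \<otimes>\<^bsub>TL n \<tau>\<^esub> TL_e n \<tau> i = \<tau> \<odot>\<^bsub>TL n \<tau>\<^esub> TL_e n \<tau> i"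
    using gen_TL_carrier ij by (simp add: TL.cls_simps TL.cls_gen carrier_free_algebra_mult del: One_nat_def)
qed

lemma gamma_closed: "1 \<le> i \<Longrightarrow> i < j \<Longrightarrow> j \<le> n \<Longrightarrow> \<gamma> j i \<in> carrier band_algebra"
  using band.gen_closed[of "Gen (j, i)"]
  by (simp add: inv_presented_gen_def inverse_gens_def g_index_def)

lemma cls_g_gen: "band.cls (g_gen j i) = \<gamma> j i"
  by (simp add: band.cls_gen inv_presented_gen_def)

lemmas g_gen_intros = g_gen_carrier carrier_free_algebra_intros

lemma gamma_commute:
  assumes "1 \<le> k" "k < l" "l \<le> n" "1 \<le> i" "i < j" "j \<le> n"
    and "(int l - int j) * (int l - int i) * (int k - int j) * (int k - int i) > 0"
  shows "\<gamma> l k \<otimes>\<^bsub>band_algebra\<^esub> \<gamma> j i = \<gamma> j i \<otimes>\<^bsub>band_algebra\<^esub> \<gamma> l k"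
proof -
  have "g_gen l k * g_gen j i - g_gen j i * g_gen l k \<in> g_relations n t"
    unfolding g_relations_def
    by (intro UnI1 CollectI exI[of _ i] exI[of _ j] exI[of _ k] exI[of _ l]) (use assms in auto)
  then have "band.cls (g_gen l k * g_gen j i) = band.cls (g_gen j i * g_gen l k)"
    using assms by (intro band.cls_relation_eq g_gen_intros) auto
  then show ?thesis
    using assms by (simp add: band.cls_simps cls_g_gen g_gen_carrier)
qed

lemma gamma_quadratic:
  assumes "1 \<le> i" "i < j" "j \<le> n"
  shows "\<gamma> j i \<otimes>\<^bsub>band_algebra\<^esub> \<gamma> j i =
    (t - 1) \<odot>\<^bsub>band_algebra\<^esub> \<gamma> j i \<oplus>\<^bsub>band_algebra\<^esub> t \<odot>\<^bsub>band_algebra\<^esub> \<one>\<^bsub>band_algebra\<^esub>"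
proof -
  have "g_gen j i * g_gen j i - (scale (t - 1) (g_gen j i) + scale t 1) \<in> g_relations n t"
    using assms unfolding g_relations_def by blast
  then have "band.cls (g_gen j i * g_gen j i) = band.cls (scale (t - 1) (g_gen j i) + scale t 1)"
    using assms by (intro band.cls_relation_eq g_gen_intros) auto
  then show ?thesis
    using assms by (simp add: band.cls_simps cls_g_gen g_gen_intros)
qed

lemma gamma_triple_relations:
  assumes "1 \<le> i" "i < j" "j < k" "k \<le> n"
  shows "\<gamma> k j \<otimes>\<^bsub>band_algebra\<^esub> \<gamma> j i = \<gamma> j i \<otimes>\<^bsub>band_algebra\<^esub> \<gamma> k i"
    and "\<gamma> j i \<otimes>\<^bsub>band_algebra\<^esub> \<gamma> k i = \<gamma> k i \<otimes>\<^bsub>band_algebra\<^esub> \<gamma> k j"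
    and "\<gamma> j i \<otimes>\<^bsub>band_algebra\<^esub> \<gamma> k j \<oplus>\<^bsub>band_algebra\<^esub>
      t \<odot>\<^bsub>band_algebra\<^esub> (\<gamma> k j \<otimes>\<^bsub>band_algebra\<^esub> \<gamma> j i) \<oplus>\<^bsub>band_algebra\<^esub> \<gamma> k j
      \<oplus>\<^bsub>band_algebra\<^esub> \<gamma> j i \<oplus>\<^bsub>band_algebra\<^esub> t \<odot>\<^bsub>band_algebra\<^esub> \<gamma> k i
      \<oplus>\<^bsub>band_algebra\<^esub> \<one>\<^bsub>band_algebra\<^esub> = \<zero>\<^bsub>band_algebra\<^esub>"
proof -
  have "g_gen k j * g_gen j i - g_gen j i * g_gen k i \<in> g_relations n t"
    "g_gen j i * g_gen k i - g_gen k i * g_gen k j \<in> g_relations n t"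
    and 3: "g_gen j i * g_gen k j + scale t (g_gen k j * g_gen j i) + g_gen k j + g_gen j i +
       scale t (g_gen k i) + 1 \<in> g_relations n t"
    using assms unfolding g_relations_def by blast+
  then have "band.cls (g_gen k j * g_gen j i) = band.cls (g_gen j i * g_gen k i)"
    "band.cls (g_gen j i * g_gen k i) = band.cls (g_gen k i * g_gen k j)"
    using assms by (intro band.cls_relation_eq g_gen_intros; auto)+
  then show "\<gamma> k j \<otimes>\<^bsub>band_algebra\<^esub> \<gamma> j i = \<gamma> j i \<otimes>\<^bsub>band_algebra\<^esub> \<gamma> k i"
    "\<gamma> j i \<otimes>\<^bsub>band_algebra\<^esub> \<gamma> k i = \<gamma> k i \<otimes>\<^bsub>band_algebra\<^esub> \<gamma> k j"
    using assms by (simp_all add: band.cls_simps cls_g_gen g_gen_carrier)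
  show "\<gamma> j i \<otimes>\<^bsub>band_algebra\<^esub> \<gamma> k j \<oplus>\<^bsub>band_algebra\<^esub>
      t \<odot>\<^bsub>band_algebra\<^esub> (\<gamma> k j \<otimes>\<^bsub>band_algebra\<^esub> \<gamma> j i) \<oplus>\<^bsub>band_algebra\<^esub> \<gamma> k j
      \<oplus>\<^bsub>band_algebra\<^esub> \<gamma> j i \<oplus>\<^bsub>band_algebra\<^esub> t \<odot>\<^bsub>band_algebra\<^esub> \<gamma> k i
      \<oplus>\<^bsub>band_algebra\<^esub> \<one>\<^bsub>band_algebra\<^esub> = \<zero>\<^bsub>band_algebra\<^esub>"
    using assms band.cls_relation[OF UnI1[OF 3]]
    by (simp add: band.cls_simps cls_g_gen g_gen_intros)
qed

text \<open>By uniqueness of inverses the class of \<open>Gen_inv\<close> is the ring inverse, so a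
  homomorphism out of the band algebra is already determined by its values on the
  \<open>\<gamma> j i\<close>.\<close>

lemma gamma_inverse:
  assumes "1 \<le> i" "i < j" "j \<le> n"
  shows "\<gamma> j i \<in> Units band_algebra"
    and "presented_gen band_index band_relations (Gen_inv (j, i)) = inv\<^bsub>band_algebra\<^esub> (\<gamma> j i)"
proof -
  have ji: "(j, i) \<in> g_index n" using assms by (simp add: g_index_def)
  let ?p = "gen (Gen (j, i)) :: (nat \<times> nat) with_inverse nc_poly"
  let ?q = "gen (Gen_inv (j, i)) :: (nat \<times> nat) with_inverse nc_poly"
  have "?p * ?q - 1 \<in> inverse_relations (g_index n)" "?q * ?p - 1 \<in> inverse_relations (g_index n)"
    using ji unfolding inverse_relations_def by blast+
  then have "band.cls (?p * ?q) = band.cls 1" "band.cls (?q * ?p) = band.cls 1"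
    using inverse_gen_carrier[OF ji]
    by (intro band.cls_relation_eq; simp add: carrier_free_algebra_intros)+
  then have "band.cls ?p \<otimes>\<^bsub>band_algebra\<^esub> band.cls ?q = \<one>\<^bsub>band_algebra\<^esub>"
    "band.cls ?q \<otimes>\<^bsub>band_algebra\<^esub> band.cls ?p = \<one>\<^bsub>band_algebra\<^esub>"
    using inverse_gen_carrier[OF ji] by (simp_all add: band.cls_simps)
  from band.UnitsI_inv[OF _ _ this] algebra_homD(1)[OF band.cls_algebra_hom] inverse_gen_carrier[OF ji]
  have "band.cls ?p \<in> Units band_algebra" "inv\<^bsub>band_algebra\<^esub> (band.cls ?p) = band.cls ?q"
    by blast+
  then
  show "\<gamma> j i \<in> Units band_algebra"
    and "presented_gen band_index band_relations (Gen_inv (j, i)) = inv\<^bsub>band_algebra\<^esub> (\<gamma> j i)"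
    by (simp_all add: inv_presented_gen_def band.cls_gen)
qed

text \<open>
  The shifted generator \<open>h\<^sub>i + 1\<close> is \<open>(t + 1) e\<^sub>i\<close>, which turns the relations of \<open>e\<^sub>i\<close> into those
  of \<open>h\<^sub>i\<close> and back.
\<close>

lemma TL_h_generators: "TL_generators (TL n \<tau>) n t (TL_h n \<tau> t)"
proof -
  define x where "x i = (t + 1) \<odot>\<^bsub>TL n \<tau>\<^esub> TL_e n \<tau> i" for i
  have x: "x i \<in> carrier (TL n \<tau>)" if "1 \<le> i" "i < n" for i
    using that by (simp add: x_def TL_e_closed)
  have h: "TL_h n \<tau> t i = x i \<ominus>\<^bsub>TL n \<tau>\<^esub> \<one>\<^bsub>TL n \<tau>\<^esub>" for i by (simp add: TL_h_def x_def)
  have h_closed: "TL_h n \<tau> t i \<in> carrier (TL n \<tau>)" if "1 \<le> i" "i < n" for i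
    using that x by (simp add: h)
  have x_square: "x i \<otimes>\<^bsub>TL n \<tau>\<^esub> x i = (t + 1) \<odot>\<^bsub>TL n \<tau>\<^esub> x i" if "1 \<le> i" "i < n" for i
    using that TL_e_relations(1)[of i] TL_e_closed[of i]
    by (simp add: x_def TL.smult_mult_left TL.smult_mult_right TL.smult_smult)
  have quadratic: "TL_h n \<tau> t i \<otimes>\<^bsub>TL n \<tau>\<^esub> TL_h n \<tau> t i =
      (t - 1) \<odot>\<^bsub>TL n \<tau>\<^esub> TL_h n \<tau> t i \<oplus>\<^bsub>TL n \<tau>\<^esub> t \<odot>\<^bsub>TL n \<tau>\<^esub> \<one>\<^bsub>TL n \<tau>\<^esub>" if "1 \<le> i" "i < n" for i
    using TL.quadratic_relation_shift_iff[OF h_closed x h] x_square that by simp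
  have cubic: "TL_h n \<tau> t i \<otimes>\<^bsub>TL n \<tau>\<^esub> TL_h n \<tau> t j \<otimes>\<^bsub>TL n \<tau>\<^esub> TL_h n \<tau> t i \<oplus>\<^bsub>TL n \<tau>\<^esub>
      TL_h n \<tau> t i \<otimes>\<^bsub>TL n \<tau>\<^esub> TL_h n \<tau> t j \<oplus>\<^bsub>TL n \<tau>\<^esub> TL_h n \<tau> t j \<otimes>\<^bsub>TL n \<tau>\<^esub> TL_h n \<tau> t i \<oplus>\<^bsub>TL n \<tau>\<^esub>
      TL_h n \<tau> t i \<oplus>\<^bsub>TL n \<tau>\<^esub> TL_h n \<tau> t j \<oplus>\<^bsub>TL n \<tau>\<^esub> \<one>\<^bsub>TL n \<tau>\<^esub> = \<zero>\<^bsub>TL n \<tau>\<^esub>"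
    if ij: "1 \<le> i" "i < n" "1 \<le> j" "j < n" "j = i + 1 \<or> i = j + 1" for i j
  proof -
    have "x i \<otimes>\<^bsub>TL n \<tau>\<^esub> x j \<otimes>\<^bsub>TL n \<tau>\<^esub> x i = (t + 1) ^ 3 \<odot>\<^bsub>TL n \<tau>\<^esub>
        (TL_e n \<tau> i \<otimes>\<^bsub>TL n \<tau>\<^esub> TL_e n \<tau> j \<otimes>\<^bsub>TL n \<tau>\<^esub> TL_e n \<tau> i)"
      using TL_e_closed ij
      by (simp add: x_def TL.smult_mult_left TL.smult_mult_right TL.smult_smult power3_eq_cube
        mult.assoc)
    also have "\<dots> = ((t + 1) ^ 3 * \<tau>) \<odot>\<^bsub>TL n \<tau>\<^esub> TL_e n \<tau> i"
      using TL_e_relations(3)[OF ij] TL_e_closed ij by (simp add: TL.smult_smult)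
    \<comment> \<open>Of the three factors \<open>t + 1\<close>, two convert \<open>\<tau>\<close>
      into \<open>t\<close> and the third converts \<open>e_i\<close> back into
      \<open>x i\<close>.\<close>
    also have "(t + 1) ^ 3 * \<tau> = (\<tau> * (t + 1)\<^sup>2) * (t + 1)"
      by (simp add: power3_eq_cube power2_eq_square)
    also have "\<dots> = t * (t + 1)" by (simp only: tau_eq)
    finally have "x i \<otimes>\<^bsub>TL n \<tau>\<^esub> x j \<otimes>\<^bsub>TL n \<tau>\<^esub> x i = t \<odot>\<^bsub>TL n \<tau>\<^esub> x i"
      using TL_e_closed ij by (simp add: x_def TL.smult_smult)
    then show ?thesis
      using TL.cubic_relation_shift_iff[OF h_closed h_closed x x h h x_square] ij by simp
  qed
  show ?thesis
  proof (intro TL_generators.intro TL_generators_axioms.intro TL.complex_algebra_axioms)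
    fix i assume i: "1 \<le> i" "i < n"
    show "TL_h n \<tau> t i \<in> Units (TL n \<tau>)"
      using TL.quadratic_relation_Units[OF t_nonzero h_closed quadratic] i by simp
  next
    fix i j assume ij: "1 \<le> i" "i + 1 < j" "j < n"
    have cl: "x i \<in> carrier (TL n \<tau>)" "x j \<in> carrier (TL n \<tau>)" using ij x by simp_all
    have comm: "x i \<otimes>\<^bsub>TL n \<tau>\<^esub> x j = x j \<otimes>\<^bsub>TL n \<tau>\<^esub> x i"
      using TL_e_relations(2)[OF ij] TL_e_closed ij
      by (simp add: x_def TL.smult_mult_left TL.smult_mult_right TL.smult_smult)
    show "TL_h n \<tau> t i \<otimes>\<^bsub>TL n \<tau>\<^esub> TL_h n \<tau> t j = TL_h n \<tau> t j \<otimes>\<^bsub>TL n \<tau>\<^esub> TL_h n \<tau> t i"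
      using cl comm by (simp add: h TL.ring_normalize)
  next
    fix i assume i: "1 \<le> i" "i + 1 < n"
    show "TL_h n \<tau> t i \<otimes>\<^bsub>TL n \<tau>\<^esub> TL_h n \<tau> t (i + 1) \<otimes>\<^bsub>TL n \<tau>\<^esub> TL_h n \<tau> t i =
        TL_h n \<tau> t (i + 1) \<otimes>\<^bsub>TL n \<tau>\<^esub> TL_h n \<tau> t i \<otimes>\<^bsub>TL n \<tau>\<^esub> TL_h n \<tau> t (i + 1)"
      \<comment> \<open>Both orientations of the cubic relation are at hand, since the relations of
        the idempotents are symmetric in neighbours.\<close>
      by (rule TL.cubic_relations_imp_braid; (rule h_closed cubic)?) (use i in auto)
  qed (use quadratic cubic in auto)
qed

sublocale H: TL_generators "TL n \<tau>" n t "TL_h n \<tau> t"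
  by (rule TL_h_generators)

lemma TL_g_eq_band: "TL_g n \<tau> t j i = H.band j i"
  by (simp add: TL_g_def H.band_def)

section \<open>The homomorphisms in both directions\<close>

lemma band_hom_ex:
  "\<exists>\<phi>\<in>algebra_hom band_algebra (TL n \<tau>).
    \<forall>j i. (j, i) \<in> g_index n \<longrightarrow> \<phi> (\<gamma> j i) = TL_g n \<tau> t j i"
proof -
  define F where "F x = (case x of Gen (j, i) \<Rightarrow> H.band j i
    | Gen_inv (j, i) \<Rightarrow> inv\<^bsub>TL n \<tau>\<^esub> (H.band j i))" for x :: "(nat \<times> nat) with_inverse"
  have F: "F x \<in> carrier (TL n \<tau>)" if "x \<in> band_index" for x
    using that by (auto simp: F_def inverse_gens_def g_index_def H.band_Units)
  have "\<exists>\<phi>\<in>algebra_hom band_algebra (TL n \<tau>). \<forall>x\<in>band_index.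
      \<phi> (presented_gen band_index band_relations x) = F x"
  proof (rule band.universal_property[OF TL.complex_algebra_axioms F])
    fix f r
    assume f: "f \<in> algebra_hom (free_algebra band_index) (TL n \<tau>)"
      and gen: "\<And>x. x \<in> band_index \<Longrightarrow> f (gen x) = F x"
      and r: "r \<in> band_relations"
    note f_simps = free_algebra_hom_simps[OF TL.complex_algebra_axioms f]
    have fg: "f (g_gen j i) = H.band j i" if "1 \<le> i" "i < j" "j \<le> n" for j i
      using gen[of "Gen (j, i)"] that by (simp add: inverse_gens_def g_index_def F_def)
    have fi: "f (gen (Gen_inv (j, i))) = inv\<^bsub>TL n \<tau>\<^esub> (H.band j i)"
      if "1 \<le> i" "i < j" "j \<le> n" for j i
      using gen[of "Gen_inv (j, i)"] that by (simp add: inverse_gens_def g_index_def F_def)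
    note simps = f_simps fg fi g_gen_intros TL.minus_self
    from r show "f r = \<zero>\<^bsub>TL n \<tau>\<^esub>"
      unfolding g_relations_def inverse_relations_def
    proof (elim UnE CollectE exE conjE)
      fix i j k l
      assume *: "1 \<le> k" "k < l" "l \<le> n" "1 \<le> i" "i < j" "j \<le> n"
        "(int l - int j) * (int l - int i) * (int k - int j) * (int k - int i) > 0"
        and r: "r = g_gen l k * g_gen j i - g_gen j i * g_gen l k"
      show ?thesis using * H.band_commute[OF *] by (simp add: r simps)
    next
      fix i j k assume *: "1 \<le> i" "i < j" "j < k" "k \<le> n"
        and r: "r = g_gen k j * g_gen j i - g_gen j i * g_gen k i"
      show ?thesis using * H.band_triple_relations(1)[OF *] by (simp add: r simps)
    next
      fix i j k assume *: "1 \<le> i" "i < j" "j < k" "k \<le> n"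
        and r: "r = g_gen j i * g_gen k i - g_gen k i * g_gen k j"
      show ?thesis using * H.band_triple_relations(2)[OF *] by (simp add: r simps)
    next
      fix i j assume *: "1 \<le> i" "i < j" "j \<le> n"
        and r: "r = g_gen j i * g_gen j i - (scale (t - 1) (g_gen j i) + scale t 1)"
      show ?thesis using * H.band_quadratic[OF *] by (simp add: r simps)
    next
      fix i j k assume *: "1 \<le> i" "i < j" "j < k" "k \<le> n"
        and r: "r = g_gen j i * g_gen k j + scale t (g_gen k j * g_gen j i) + g_gen k j +
          g_gen j i + scale t (g_gen k i) + 1"
      show ?thesis using * H.band_triple_relations(3)[OF *] by (simp add: r simps)
    next
      fix x assume x: "x \<in> g_index n" and r: "r = gen (Gen x) * gen (Gen_inv x) - 1"
      obtain j i where "x = (j, i)" "1 \<le> i" "i < j" "j \<le> n" using x by (auto simp: g_index_def)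
      then show ?thesis
        using inverse_gen_carrier[OF x] H.band_Units[of i j] by (simp add: r simps)
    next
      fix x assume x: "x \<in> g_index n" and r: "r = gen (Gen_inv x) * gen (Gen x) - 1"
      obtain j i where "x = (j, i)" "1 \<le> i" "i < j" "j \<le> n" using x by (auto simp: g_index_def)
      then show ?thesis
        using inverse_gen_carrier[OF x] H.band_Units[of i j] by (simp add: r simps)
    qed
  qed
  then obtain \<phi> where "\<phi> \<in> algebra_hom band_algebra (TL n \<tau>)"
    and "\<And>x. x \<in> band_index \<Longrightarrow> \<phi> (presented_gen band_index band_relations x) = F x" by blast
  then show ?thesis
    by (intro bexI[of _ \<phi>])
      (auto simp: inv_presented_gen_def inverse_gens_def F_def TL_g_eq_band)
qed

text \<open>The value on \<open>e_i\<close> is found by solving \<open>h_i = (t + 1) e_i - 1\<close>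
  for \<open>e_i\<close> and sending \<open>h_i\<close> to
  \<open>\<gamma> (Suc i) i\<close>.\<close>

lemma TL_hom_ex:
  "\<exists>\<psi>\<in>algebra_hom (TL n \<tau>) band_algebra. \<forall>i\<in>{1..<n}.
    \<psi> (TL_e n \<tau> i) = inverse (t + 1) \<odot>\<^bsub>band_algebra\<^esub> (\<gamma> (Suc i) i \<oplus>\<^bsub>band_algebra\<^esub> \<one>\<^bsub>band_algebra\<^esub>)"
proof -
  define x where "x i = \<gamma> (Suc i) i \<oplus>\<^bsub>band_algebra\<^esub> \<one>\<^bsub>band_algebra\<^esub>" for i
  define F where "F i = inverse (t + 1) \<odot>\<^bsub>band_algebra\<^esub> x i" for i
  have g: "\<gamma> (Suc i) i \<in> carrier band_algebra" if "1 \<le> i" "i < n" for i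
    using that by (simp add: gamma_closed)
  have x: "x i \<in> carrier band_algebra" if "1 \<le> i" "i < n" for i
    using that g by (simp add: x_def)
  have F: "F i \<in> carrier band_algebra" if "i \<in> {1..<n}" for i
    using that x by (simp add: F_def)
  have gx: "\<gamma> (Suc i) i = x i \<ominus>\<^bsub>band_algebra\<^esub> \<one>\<^bsub>band_algebra\<^esub>" if "1 \<le> i" "i < n" for i
    using g[OF that] by (simp add: x_def a_minus_def band.a_assoc band.r_neg)
  have x_square: "x i \<otimes>\<^bsub>band_algebra\<^esub> x i = (t + 1) \<odot>\<^bsub>band_algebra\<^esub> x i" if "1 \<le> i" "i < n" for i
    using band.quadratic_relation_shift_iff[OF g x gx] gamma_quadratic[of i "Suc i"] that by simp
  have x_cube: "x i \<otimes>\<^bsub>band_algebra\<^esub> x j \<otimes>\<^bsub>band_algebra\<^esub> x i = t \<odot>\<^bsub>band_algebra\<^esub> x i"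
    if "1 \<le> i" "i < n" "1 \<le> j" "j < n" "j = i + 1 \<or> i = j + 1" for i j
  proof -
    have cubic: "\<gamma> (Suc (Suc k)) (Suc k) \<otimes>\<^bsub>band_algebra\<^esub> \<gamma> (Suc k) k \<otimes>\<^bsub>band_algebra\<^esub> \<gamma> (Suc (Suc k)) (Suc k)
        \<oplus>\<^bsub>band_algebra\<^esub> \<gamma> (Suc (Suc k)) (Suc k) \<otimes>\<^bsub>band_algebra\<^esub> \<gamma> (Suc k) k
        \<oplus>\<^bsub>band_algebra\<^esub> \<gamma> (Suc k) k \<otimes>\<^bsub>band_algebra\<^esub> \<gamma> (Suc (Suc k)) (Suc k)
        \<oplus>\<^bsub>band_algebra\<^esub> \<gamma> (Suc (Suc k)) (Suc k) \<oplus>\<^bsub>band_algebra\<^esub> \<gamma> (Suc k) k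
        \<oplus>\<^bsub>band_algebra\<^esub> \<one>\<^bsub>band_algebra\<^esub> = \<zero>\<^bsub>band_algebra\<^esub>" (is ?A)
      "\<gamma> (Suc k) k \<otimes>\<^bsub>band_algebra\<^esub> \<gamma> (Suc (Suc k)) (Suc k) \<otimes>\<^bsub>band_algebra\<^esub> \<gamma> (Suc k) k
        \<oplus>\<^bsub>band_algebra\<^esub> \<gamma> (Suc k) k \<otimes>\<^bsub>band_algebra\<^esub> \<gamma> (Suc (Suc k)) (Suc k)
        \<oplus>\<^bsub>band_algebra\<^esub> \<gamma> (Suc (Suc k)) (Suc k) \<otimes>\<^bsub>band_algebra\<^esub> \<gamma> (Suc k) k
        \<oplus>\<^bsub>band_algebra\<^esub> \<gamma> (Suc k) k \<oplus>\<^bsub>band_algebra\<^esub> \<gamma> (Suc (Suc k)) (Suc k)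
        \<oplus>\<^bsub>band_algebra\<^esub> \<one>\<^bsub>band_algebra\<^esub> = \<zero>\<^bsub>band_algebra\<^esub>" (is ?B)
      if k: "1 \<le> k" "Suc k < n" for k
    proof -
      let ?a = "\<gamma> (Suc (Suc k)) (Suc k)" and ?b = "\<gamma> (Suc k) k" and ?c = "\<gamma> (Suc (Suc k)) k"
      have cl: "?a \<in> carrier band_algebra" "?b \<in> carrier band_algebra" "?c \<in> carrier band_algebra"
        using k by (auto intro: gamma_closed)
      have rel: "?a \<otimes>\<^bsub>band_algebra\<^esub> ?b = ?b \<otimes>\<^bsub>band_algebra\<^esub> ?c"
        "?b \<otimes>\<^bsub>band_algebra\<^esub> ?c = ?c \<otimes>\<^bsub>band_algebra\<^esub> ?a"
        using gamma_triple_relations(1,2)[of k "Suc k" "Suc (Suc k)"] k by simp_all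
      have "?c \<otimes>\<^bsub>band_algebra\<^esub> ?a = ?a \<otimes>\<^bsub>band_algebra\<^esub> ?b" using rel by simp
      from band.band_relation_eq_cubic_relation[OF cl gamma_quadratic this]
      show ?A
        using gamma_triple_relations(3)[of k "Suc k" "Suc (Suc k)"] k by simp
      \<comment> \<open>The band relations supply only the first orientation. The equal products
        give \<open>a b a = b c a = b a b\<close>, and replacing the cubic term turns it into the
        second.\<close>
      moreover have "?a \<otimes>\<^bsub>band_algebra\<^esub> ?b \<otimes>\<^bsub>band_algebra\<^esub> ?a = ?b \<otimes>\<^bsub>band_algebra\<^esub> (?c \<otimes>\<^bsub>band_algebra\<^esub> ?a)"
        using cl by (simp add: rel(1) band.m_assoc)
      then have "?a \<otimes>\<^bsub>band_algebra\<^esub> ?b \<otimes>\<^bsub>band_algebra\<^esub> ?a = ?b \<otimes>\<^bsub>band_algebra\<^esub> ?a \<otimes>\<^bsub>band_algebra\<^esub> ?b"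
        using cl by (simp only: rel(2)[symmetric] rel(1)[symmetric] band.m_assoc)
      ultimately show ?B
        using cl by (simp add: band.a_ac)
    qed
    have "Suc j = i \<or> Suc i = j" using that by auto
    then show ?thesis
      using band.cubic_relation_shift_iff[OF g g x x gx gx x_square] cubic[of i] cubic[of j] that
      by auto
  qed
  have "\<exists>\<psi>\<in>algebra_hom (TL n \<tau>) band_algebra. \<forall>i\<in>{1..<n}. \<psi> (TL_e n \<tau> i) = F i"
  proof (rule TL.universal_property[OF band.complex_algebra_axioms F])
    fix f r
    assume f: "f \<in> algebra_hom (free_algebra {1..<n}) band_algebra"
      and gen: "\<And>i. i \<in> {1..<n} \<Longrightarrow> f (gen i) = F i"
      and r: "r \<in> TL_relations n \<tau>"
    note f_simps = free_algebra_hom_simps[OF band.complex_algebra_axioms f]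
    note simps = f_simps gen carrier_free_algebra_intros band.minus_self F_def
      band.smult_mult_left band.smult_mult_right band.smult_smult
    from r show "f r = \<zero>\<^bsub>band_algebra\<^esub>"
      unfolding TL_relations_def
    proof (elim UnE CollectE exE conjE)
      fix i j assume ij: "i \<in> {1..<n}" "j \<in> {1..<n}" "\<bar>int i - int j\<bar> \<ge> 2"
        and r: "r = gen i * gen j - gen j * gen i"
      have cl: "\<gamma> (Suc i) i \<in> carrier band_algebra" "\<gamma> (Suc j) j \<in> carrier band_algebra"
        using ij g by auto
      \<comment> \<open>For the pairs \<open>(i+1, i)\<close> and \<open>(j+1, j)\<close> with
        \<open>d = i - j\<close> the crossing condition becomes
        \<open>d^2 (d + 1)(d - 1) > 0\<close>, that is, distance at least 2.\<close>
      have "(int (Suc i) - int (Suc j)) * (int (Suc i) - int j) * (int i - int (Suc j)) * (int i - int j) =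
        (int i - int j)\<^sup>2 * ((int i - int j)\<^sup>2 - 1)"
        by (simp add: power2_eq_square algebra_simps)
      also have "\<dots> > 0"
        using power_mono[OF ij(3), of 2] by (intro mult_pos_pos) auto
      finally have "(int (Suc i) - int (Suc j)) * (int (Suc i) - int j) * (int i - int (Suc j)) *
        (int i - int j) > 0" .
      then have "\<gamma> (Suc i) i \<otimes>\<^bsub>band_algebra\<^esub> \<gamma> (Suc j) j = \<gamma> (Suc j) j \<otimes>\<^bsub>band_algebra\<^esub> \<gamma> (Suc i) i"
        using ij by (intro gamma_commute) auto
      then have "x i \<otimes>\<^bsub>band_algebra\<^esub> x j = x j \<otimes>\<^bsub>band_algebra\<^esub> x i"
        using cl by (simp add: x_def band.l_distr band.r_distr band.a_ac)
      then show ?thesis using ij x by (simp add: r simps)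
    next
      fix i assume i: "i \<in> {1..<n}" and r: "r = gen i * gen i - gen i"
      show ?thesis using i x x_square[of i] t_plus_one_nonzero by (simp add: r simps)
    next
      fix i j assume ij: "i \<in> {1..<n}" "j \<in> {1..<n}" "j = i + 1 \<or> i = j + 1"
        and r: "r = gen i * gen j * gen i - scale \<tau> (gen i)"
      have cl: "x i \<in> carrier band_algebra" "x j \<in> carrier band_algebra" using ij x by auto
      have cube: "x i \<otimes>\<^bsub>band_algebra\<^esub> x j \<otimes>\<^bsub>band_algebra\<^esub> x i = t \<odot>\<^bsub>band_algebra\<^esub> x i"
        using x_cube[of i j] ij by auto
      \<comment> \<open>Substituting \<open>t = \<tau> (t + 1)^2\<close> cancels two of the three
        inverse factors. The identity is proved for a variable \<open>c\<close> so that
        \<open>t + 1\<close> is treated as one atom.\<close>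
      have scalar: "inverse (t + 1) * (inverse (t + 1) * (inverse (t + 1) * t)) = \<tau> * inverse (t + 1)"
      proof -
        have "inverse c * (inverse c * (inverse c * (\<tau> * c\<^sup>2))) = \<tau> * inverse c" if "c \<noteq> 0" for c
          using that by (simp add: power2_eq_square field_simps)
        from this[OF t_plus_one_nonzero] show ?thesis by (simp only: tau_eq)
      qed
      have "F i \<otimes>\<^bsub>band_algebra\<^esub> F j \<otimes>\<^bsub>band_algebra\<^esub> F i =
          (inverse (t + 1) * (inverse (t + 1) * (inverse (t + 1) * t))) \<odot>\<^bsub>band_algebra\<^esub> x i"
        using cl cube
        by (simp add: F_def band.smult_mult_left band.smult_mult_right band.smult_smult mult.assoc)
      also have "\<dots> = \<tau> \<odot>\<^bsub>band_algebra\<^esub> F i"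
        unfolding scalar F_def using cl by (simp add: band.smult_smult)
      finally have "F i \<otimes>\<^bsub>band_algebra\<^esub> F j \<otimes>\<^bsub>band_algebra\<^esub> F i = \<tau> \<odot>\<^bsub>band_algebra\<^esub> F i" .
      then show ?thesis
        using ij F[of i] by (simp add: r f_simps gen carrier_free_algebra_intros band.minus_self)
    qed
  qed
  then show ?thesis by (simp add: F_def x_def)
qed

end

section \<open>The isomorphism\<close>

theorem theorem2:
  fixes n :: nat and \<tau> t :: complex
  assumes "\<tau> \<noteq> 0" and "t \<noteq> 0" and "inverse \<tau> = 2 + t + inverse t"
  shows "(\<forall>i\<in>{1..<n}. TL_h n \<tau> t i \<in> Units (TL n \<tau>)) \<and>
    (\<exists>\<phi>\<in>algebra_iso (inv_presented_algebra (g_index n) (g_relations n t)) (TL n \<tau>).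
       \<forall>j i. (j, i) \<in> g_index n \<longrightarrow>
         \<phi> (inv_presented_gen (g_index n) (g_relations n t) (j, i)) = TL_g n \<tau> t j i)"
proof -
  interpret TL_parameters n \<tau> t using assms by unfold_locales
  note algebras = TL.complex_algebra_axioms band.complex_algebra_axioms
  obtain \<phi> where \<phi>: "\<phi> \<in> algebra_hom band_algebra (TL n \<tau>)"
    and \<phi>_gamma: "\<And>j i. (j, i) \<in> g_index n \<Longrightarrow> \<phi> (\<gamma> j i) = H.band j i"
    using band_hom_ex by (auto simp: TL_g_eq_band)
  obtain \<psi> where \<psi>: "\<psi> \<in> algebra_hom (TL n \<tau>) band_algebra"
    and \<psi>_e: "\<And>i. i \<in> {1..<n} \<Longrightarrow> \<psi> (TL_e n \<tau> i) =
      inverse (t + 1) \<odot>\<^bsub>band_algebra\<^esub> (\<gamma> (Suc i) i \<oplus>\<^bsub>band_algebra\<^esub> \<one>\<^bsub>band_algebra\<^esub>)"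
    using TL_hom_ex by auto
  note \<phi>D = algebra_homD[OF \<phi>] and \<psi>D = algebra_homD[OF \<psi>]
  have \<psi>_h: "\<psi> (TL_h n \<tau> t i) = \<gamma> (Suc i) i" if i: "1 \<le> i" "i < n" for i
  proof -
    have cl: "TL_e n \<tau> i \<in> carrier (TL n \<tau>)" "\<gamma> (Suc i) i \<in> carrier band_algebra"
      using i by (simp_all add: TL_e_closed gamma_closed)
    have "\<psi> (TL_h n \<tau> t i) = (t + 1) \<odot>\<^bsub>band_algebra\<^esub> \<psi> (TL_e n \<tau> i) \<ominus>\<^bsub>band_algebra\<^esub> \<one>\<^bsub>band_algebra\<^esub>"
      using cl \<psi>D(4,5) by (simp add: TL_h_def algebra_hom_minus[OF algebras \<psi>])
    also have "\<dots> = \<gamma> (Suc i) i"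
      using cl i \<psi>_e[of i] t_plus_one_nonzero
      by (simp add: band.smult_smult a_minus_def band.a_assoc band.r_neg)
    finally show ?thesis .
  qed
  have \<psi>_band: "\<psi> (H.band j i) = \<gamma> j i" if "1 \<le> i" "i < j" "j \<le> n" for i j
  proof -
    have "Suc i \<le> j" using that by simp
    then show ?thesis using that(3)
    proof (induction j rule: dec_induct)
      case base
      then show ?case using that by (simp add: H.band_Suc_self \<psi>_h)
    next
      case (step j)
      have j: "1 \<le> i" "i < j" "j < n" "j \<le> n" "1 \<le> j" using step.hyps step.prems that by auto
      have U: "TL_h n \<tau> t j \<in> Units (TL n \<tau>)" and cl: "H.band j i \<in> carrier (TL n \<tau>)"
        using j by (auto intro: H.h_Units H.band_closed)
      have hc: "TL_h n \<tau> t j \<in> carrier (TL n \<tau>)" "inv\<^bsub>TL n \<tau>\<^esub> (TL_h n \<tau> t j) \<in> carrier (TL n \<tau>)"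
        using U by auto
      have gU: "\<gamma> (Suc j) j \<in> Units band_algebra" using j by (simp add: gamma_inverse)
      have gc: "\<gamma> (Suc j) j \<in> carrier band_algebra" "inv\<^bsub>band_algebra\<^esub> (\<gamma> (Suc j) j) \<in> carrier band_algebra"
        "\<gamma> (Suc j) i \<in> carrier band_algebra"
        using gU j by (auto intro: gamma_closed)
      have "\<psi> (H.band (Suc j) i) = \<gamma> (Suc j) j \<otimes>\<^bsub>band_algebra\<^esub> \<gamma> j i \<otimes>\<^bsub>band_algebra\<^esub>
          inv\<^bsub>band_algebra\<^esub> (\<gamma> (Suc j) j)"
        using j U cl hc step.IH
        by (simp add: H.band_Suc TL.conj_by_def \<psi>D(2) \<psi>_h algebra_hom_inv[OF algebras \<psi>])
      also have "\<gamma> (Suc j) j \<otimes>\<^bsub>band_algebra\<^esub> \<gamma> j i = \<gamma> (Suc j) i \<otimes>\<^bsub>band_algebra\<^esub> \<gamma> (Suc j) j"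
        using gamma_triple_relations(1,2)[of i j "Suc j"] j by simp
      also have "\<gamma> (Suc j) i \<otimes>\<^bsub>band_algebra\<^esub> \<gamma> (Suc j) j \<otimes>\<^bsub>band_algebra\<^esub> inv\<^bsub>band_algebra\<^esub> (\<gamma> (Suc j) j) =
          \<gamma> (Suc j) i"
        using gU gc by (simp add: band.m_assoc)
      finally show ?case .
    qed
  qed
  have "\<psi> (\<phi> a) = a" if a: "a \<in> carrier band_algebra" for a
  proof -
    \<comment> \<open>The letters include the formal inverses; for these the claim follows from the
      one for \<open>\<gamma> j i\<close>, because homomorphisms preserve inverses.\<close>
    have "(\<psi> \<circ> \<phi>) (presented_gen band_index band_relations x) =
        presented_gen band_index band_relations x" if x: "x \<in> band_index" for x
    proof -
      obtain j i where ji: "1 \<le> i" "i < j" "j \<le> n" and x: "x = Gen (j, i) \<or> x = Gen_inv (j, i)"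
        using x by (auto simp: inverse_gens_def g_index_def)
      have \<psi>\<phi>: "\<psi> (\<phi> (\<gamma> j i)) = \<gamma> j i"
        using \<phi>_gamma[of j i] \<psi>_band[OF ji] ji unfolding g_index_def by simp
      have U: "\<gamma> j i \<in> Units band_algebra" using ji by (rule gamma_inverse)
      have "\<psi> (\<phi> (inv\<^bsub>band_algebra\<^esub> (\<gamma> j i))) = inv\<^bsub>band_algebra\<^esub> (\<gamma> j i)"
        using \<psi>\<phi> algebra_hom_inv[OF algebras(2,1) \<phi> U] algebra_hom_inv(2)[OF algebras \<psi>] by simp
      then show ?thesis
        using x \<psi>\<phi> gamma_inverse(2)[OF ji] by (auto simp: inv_presented_gen_def)
    qed
    then show ?thesis
      using band.hom_eqI[OF algebras(2) algebra_hom_comp[OF \<phi> \<psi>] algebra_hom_id _ a] by simp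
  qed
  moreover have "\<phi> (\<psi> b) = b" if b: "b \<in> carrier (TL n \<tau>)" for b
  proof -
    \<comment> \<open>Here the comparison is on the \<open>e_i\<close>, the letters of
      \<open>TL\<close>; they are recovered from the \<open>h_i\<close> by dividing by
      \<open>t + 1\<close>.\<close>
    have "(\<phi> \<circ> \<psi>) (TL_e n \<tau> i) = TL_e n \<tau> i" if i: "i \<in> {1..<n}" for i
    proof -
      have cl: "TL_e n \<tau> i \<in> carrier (TL n \<tau>)" "\<gamma> (Suc i) i \<in> carrier band_algebra"
        using i by (simp_all add: TL_e_closed gamma_closed)
      have "\<phi> (\<gamma> (Suc i) i) = TL_h n \<tau> t i"
        using \<phi>_gamma[of "Suc i" i] i unfolding g_index_def by (simp add: H.band_Suc_self)
      then have "\<phi> (\<psi> (TL_e n \<tau> i)) =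
          inverse (t + 1) \<odot>\<^bsub>TL n \<tau>\<^esub> (TL_h n \<tau> t i \<oplus>\<^bsub>TL n \<tau>\<^esub> \<one>\<^bsub>TL n \<tau>\<^esub>)"
        using i cl \<phi>D by (simp add: \<psi>_e)
      also have "TL_h n \<tau> t i \<oplus>\<^bsub>TL n \<tau>\<^esub> \<one>\<^bsub>TL n \<tau>\<^esub> = (t + 1) \<odot>\<^bsub>TL n \<tau>\<^esub> TL_e n \<tau> i"
        using cl by (simp add: TL_h_def a_minus_def TL.a_assoc TL.l_neg)
      finally show ?thesis using cl t_plus_one_nonzero by (simp add: TL.smult_smult)
    qed
    then show ?thesis
      using TL.hom_eqI[OF algebras(1) algebra_hom_comp[OF \<psi> \<phi>] algebra_hom_id _ b] by simp
  qed
  ultimately have "\<phi> \<in> algebra_iso band_algebra (TL n \<tau>)"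
    by (intro algebra_isoI[OF \<phi> \<psi>])
  then show ?thesis
    using \<phi>_gamma H.h_Units by (auto simp: TL_g_eq_band)
qed

end
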